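(* Let $N\ge 1$, let $B$ be the unit ball of $\mathbb{R}^N$, and let $f\in C^1(\mathbb{R})$. Assume that there exists $a\in\mathbb{R}$ such that $f(a)>0$ and $f(t)\ge 0$ for all $t>a$, and, with $F(t)=\int_a^t f(s)\,ds$, that $\int^{+\infty}\frac{dt}{\sqrt{F(t)}}<+\infty$. Assume in addition that there exist a nondecreasing function $\tilde f:\mathbb{R}\to\mathbb{R}$ and a constant $K$ such that $f(t)=\tilde f(t)-Kt$ for all $t\in\mathbb{R}$. Let $u$ be a large solution of $\Delta u=f(u)$ in $B$. Then $u$ is radially symmetric. Furthermore, $\frac{\partial u}{\partial r}>0$ in $B\setminus\{0\}$, where $r=|x|$.
   Context: A large solution of $\Delta u=f(u)$ in $B$ is a classical solution $u$ of $\Delta u=f(u)$ in $B$ such that $\lim_{x\to x_0,\,x\in B}u(x)=+\infty$ for every $x_0\in\partial B$. *)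

theory Defs
  imports "HOL-Analysis.Analysis"
begin

(* On an open set, existence of a continuous second Frechet derivative is the
   same as existence and continuity of all partial derivatives up to order two. *)
definition C2_on :: "('a::euclidean_space \<Rightarrow> real) \<Rightarrow> 'a set \<Rightarrow> bool" where
  "C2_on u S \<longleftrightarrow>
     (\<exists>(Du :: 'a \<Rightarrow> 'a \<Rightarrow>\<^sub>L real) (D2u :: 'a \<Rightarrow> 'a \<Rightarrow>\<^sub>L 'a \<Rightarrow>\<^sub>L real).
        (\<forall>x\<in>S. (u has_derivative blinfun_apply (Du x)) (at x)) \<and>
        (\<forall>x\<in>S. (Du has_derivative blinfun_apply (D2u x)) (at x)) \<and>
        continuous_on S D2u)"

definition directional_deriv ::
    "'a::euclidean_space \<Rightarrow> ('a \<Rightarrow> real) \<Rightarrow> 'a \<Rightarrow> real" where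
  "directional_deriv b u x = deriv (\<lambda>t. u (x + t *\<^sub>R b)) 0"

definition laplacian :: "('a::euclidean_space \<Rightarrow> real) \<Rightarrow> 'a \<Rightarrow> real" where
  "laplacian u x = (\<Sum>b\<in>Basis. directional_deriv b (directional_deriv b u) x)"

(* The values of u outside the open set S are irrelevant. *)
definition large_solution ::
    "(real \<Rightarrow> real) \<Rightarrow> 'a::euclidean_space set \<Rightarrow> ('a \<Rightarrow> real) \<Rightarrow> bool" where
  "large_solution f S u \<longleftrightarrow>
     C2_on u S \<and>
     (\<forall>x\<in>S. laplacian u x = f (u x)) \<and>
     (\<forall>x0\<in>frontier S. filterlim u at_top (at x0 within S))"

definition radially_symmetric_on ::
    "'a::euclidean_space set \<Rightarrow> ('a \<Rightarrow> real) \<Rightarrow> bool" where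
  "radially_symmetric_on S u \<longleftrightarrow> (\<exists>g :: real \<Rightarrow> real. \<forall>x\<in>S. u x = g (norm x))"

(* The partial derivative with respect to r = |x| in polar coordinates x = r \<omega>,
   with \<omega> = sgn x = x / |x| held fixed; only meaningful for x \<noteq> 0. *)
definition radial_deriv :: "('a::euclidean_space \<Rightarrow> real) \<Rightarrow> 'a \<Rightarrow> real" where
  "radial_deriv u x = deriv (\<lambda>r. u (r *\<^sub>R sgn x)) (norm x)"

end

theory Submission
  imports Defs
begin

text \<open>
  Moving planes only need control where the plane meets the sphere, since elsewhere on the boundary \<open>u\<close>
  is infinite while its reflection is finite. That control is \<open>boundary_comparison\<close>: up to an arbitrarily
  small error near the sphere, \<open>u\<close> at a point dominates \<open>u\<close> at all points of smaller norm.

  Let \<open>M r\<close> and \<open>m r\<close> be the maximum and minimum of \<open>u\<close> over the sphere of radius \<open>r\<close>. As \<open>f\<close> is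
  nonnegative for large arguments, \<open>M\<close> is eventually nondecreasing, and \<open>M\<close> and \<open>m\<close> are a sub- and a
  supersolution of the radial equation. For a map \<open>\<phi>\<close> with \<open>\<phi> r < r\<close> that corrects for curvature,
  \<open>M \<circ> \<phi> - c h\<close> is again a subsolution, where \<open>h\<close> is a concave barrier vanishing at \<open>r = 1\<close> that absorbs
  the \<open>- K t\<close> part of \<open>f\<close>. It is finite at \<open>r = 1\<close>, so it stays below \<open>m\<close>; letting \<open>\<phi>\<close> tend to the
  identity gives \<open>M - m \<le> c h\<close>, which tends to 0 at the boundary.

  The reflection argument then runs with the maximum principle on strips of width at most
  \<open>1 / sqrt (2 (K + 1))\<close> and a local strong minimum principle. Strict monotonicity in \<open>r\<close> follows from
  uniqueness for the radial ODE.
\<close>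

section \<open>Second derivatives and Laplacians along coordinate lines\<close>

text \<open>The values \<open>p\<close> and \<open>q\<close> are carried along with the function, so
  calculus rules apply without evaluating \<open>deriv\<close>. The first derivative is required
  only near \<open>t\<close> and the second only at \<open>t\<close>, which suits functions that
  matter only inside the ball.\<close>

definition has_second_deriv :: "(real \<Rightarrow> real) \<Rightarrow> real \<Rightarrow> real \<Rightarrow> real \<Rightarrow> bool" where
  "has_second_deriv g t p q \<longleftrightarrow>
     (\<exists>g'. (\<forall>\<^sub>F s in nhds t. (g has_real_derivative g' s) (at s)) \<and> g' t = p \<and>
           (g' has_real_derivative q) (at t))"

lemma has_second_derivI:
  assumes "open S" "t \<in> S" "\<And>s. s \<in> S \<Longrightarrow> (g has_real_derivative g' s) (at s)"
    and "g' t = p" "(g' has_real_derivative q) (at t)"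
  shows "has_second_deriv g t p q"
  unfolding has_second_deriv_def eventually_nhds using assms by blast

lemma has_second_deriv_imp_deriv:
  "has_second_deriv g t p q \<Longrightarrow> (g has_real_derivative p) (at t)"
  unfolding has_second_deriv_def using eventually_nhds_x_imp_x by blast

lemma has_second_deriv_add:
  assumes "has_second_deriv g t p q" "has_second_deriv k t p' q'"
  shows "has_second_deriv (\<lambda>s. g s + k s) t (p + p') (q + q')"
proof -
  obtain g' k' where g: "\<forall>\<^sub>F s in nhds t. (g has_real_derivative g' s) (at s)" "g' t = p"
      "(g' has_real_derivative q) (at t)"
    and k: "\<forall>\<^sub>F s in nhds t. (k has_real_derivative k' s) (at s)" "k' t = p'"
      "(k' has_real_derivative q') (at t)"
    using assms unfolding has_second_deriv_def by blast
  have "\<forall>\<^sub>F s in nhds t. ((\<lambda>s. g s + k s) has_real_derivative g' s + k' s) (at s)"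
    using g(1) k(1) by eventually_elim (rule DERIV_add)
  moreover have "((\<lambda>s. g' s + k' s) has_real_derivative q + q') (at t)"
    using g k by (intro DERIV_add)
  ultimately show ?thesis
    unfolding has_second_deriv_def using g(2) k(2) by (intro exI[of _ "\<lambda>s. g' s + k' s"]) auto
qed

lemma has_second_deriv_cmult:
  assumes "has_second_deriv g t p q"
  shows "has_second_deriv (\<lambda>s. c * g s) t (c * p) (c * q)"
proof -
  obtain g' where g: "\<forall>\<^sub>F s in nhds t. (g has_real_derivative g' s) (at s)" "g' t = p"
      "(g' has_real_derivative q) (at t)"
    using assms unfolding has_second_deriv_def by blast
  have "\<forall>\<^sub>F s in nhds t. ((\<lambda>s. c * g s) has_real_derivative c * g' s) (at s)"
    using g(1) by eventually_elim (rule DERIV_cmult)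
  moreover have "((\<lambda>s. c * g' s) has_real_derivative c * q) (at t)"
    using g by (intro DERIV_cmult)
  ultimately show ?thesis
    unfolding has_second_deriv_def using g(2) by (intro exI[of _ "\<lambda>s. c * g' s"]) auto
qed

lemma has_second_deriv_diff:
  assumes "has_second_deriv g t p q" "has_second_deriv k t p' q'"
  shows "has_second_deriv (\<lambda>s. g s - k s) t (p - p') (q - q')"
  using has_second_deriv_add[OF assms(1) has_second_deriv_cmult[OF assms(2), of "-1"]] by simp

lemma has_second_deriv_compose:
  assumes g: "has_second_deriv g (k t) p q" and k: "has_second_deriv k t p' q'"
  shows "has_second_deriv (\<lambda>s. g (k s)) t (p * p') (q * p'\<^sup>2 + p * q')"
proof -
  obtain g' k' where g: "\<forall>\<^sub>F s in nhds (k t). (g has_real_derivative g' s) (at s)" "g' (k t) = p"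
      "(g' has_real_derivative q) (at (k t))"
    and k: "\<forall>\<^sub>F s in nhds t. (k has_real_derivative k' s) (at s)" "k' t = p'"
      "(k' has_real_derivative q') (at t)"
    using assms unfolding has_second_deriv_def by blast
  have kt: "(k has_real_derivative p') (at t)"
    using has_second_deriv_imp_deriv assms(2) by blast
  have "filterlim k (nhds (k t)) (nhds t)"
    using DERIV_isCont[OF kt] by (simp add: isCont_def tendsto_at_iff_tendsto_nhds)
  then have "\<forall>\<^sub>F s in nhds t. (g has_real_derivative g' (k s)) (at (k s))"
    using g(1) unfolding filterlim_iff by blast
  then have "\<forall>\<^sub>F s in nhds t. ((\<lambda>s. g (k s)) has_real_derivative g' (k s) * k' s) (at s)"
    using k(1) by eventually_elim (rule DERIV_chain2)
  moreover have "((\<lambda>s. g' (k s) * k' s) has_real_derivative q * p'\<^sup>2 + p * q') (at t)"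
  proof -
    have "((\<lambda>s. g' (k s)) has_real_derivative q * p') (at t)"
      using DERIV_chain2[OF g(3) kt] .
    from DERIV_mult[OF this k(3)] show ?thesis
      using g(2) k(2) by (simp add: algebra_simps power2_eq_square)
  qed
  ultimately show ?thesis
    unfolding has_second_deriv_def using g(2) k(2)
    by (intro exI[of _ "\<lambda>s. g' (k s) * k' s"]) auto
qed

text \<open>If \<open>q < 0\<close>, the derivative, zero at \<open>t\<close>, is negative just to
  the right of \<open>t\<close>, and the mean value theorem gives smaller values there.\<close>

lemma has_second_deriv_local_min:
  assumes g: "has_second_deriv g t p q" and min: "\<forall>\<^sub>F s in nhds t. g t \<le> g s"
  shows "p = 0" "q \<ge> 0"
proof -
  obtain g' where g': "\<forall>\<^sub>F s in nhds t. (g has_real_derivative g' s) (at s)" "g' t = p"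
      "(g' has_real_derivative q) (at t)"
    using assms unfolding has_second_deriv_def by blast
  obtain d where d: "d > 0" "\<And>s. dist s t < d \<Longrightarrow> (g has_real_derivative g' s) (at s) \<and> g t \<le> g s"
    using eventually_conj[OF g'(1) min] unfolding eventually_nhds_metric by blast
  show p: "p = 0"
    using DERIV_local_min[OF has_second_deriv_imp_deriv[OF g] d(1)] d(2)
    by (auto simp: dist_real_def abs_minus_commute)
  show "q \<ge> 0"
  proof (rule ccontr)
    assume "\<not> q \<ge> 0"
    then obtain e where e: "e > 0" "\<And>h. 0 < h \<Longrightarrow> h < e \<Longrightarrow> g' (t + h) < g' t"
      using has_real_derivative_neg_dec_right[OF g'(3)] by auto
    define h where "h = min d e / 2"
    have h: "0 < h" "h < d" "h < e" using d(1) e(1) by (auto simp: h_def)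
    have "\<exists>z>t. z < t + h \<and> g (t + h) - g t = (t + h - t) * g' z"
      by (rule MVT2) (use h d(2) in \<open>auto simp: dist_real_def\<close>)
    then obtain z where z: "t < z" "z < t + h" "g (t + h) - g t = h * g' z" by auto
    have "g' z < 0" using e(2)[of "z - t"] z h p g'(2) by auto
    then have "g (t + h) < g t" using z(3) h(1) mult_pos_neg[of h "g' z"] by linarith
    moreover have "g t \<le> g (t + h)" using d(2)[of "t + h"] h by (auto simp: dist_real_def)
    ultimately show False by simp
  qed
qed

text \<open>Only the coordinate lines enter, so barriers and reflected functions obtain Laplacians
  without constructing Frechet derivatives for them.\<close>

definition has_laplacian :: "('a::euclidean_space \<Rightarrow> real) \<Rightarrow> 'a \<Rightarrow> real \<Rightarrow> bool" where
  "has_laplacian w x L \<longleftrightarrow>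
     (\<exists>p q. (\<forall>b\<in>Basis. has_second_deriv (\<lambda>t. w (x + t *\<^sub>R b)) 0 (p b) (q b)) \<and> L = sum q Basis)"

lemma has_laplacianI:
  assumes "\<And>b. b \<in> Basis \<Longrightarrow> has_second_deriv (\<lambda>t. w (x + t *\<^sub>R b)) 0 (p b) (q b)"
    and "sum q Basis = L"
  shows "has_laplacian w x L"
  unfolding has_laplacian_def using assms by blast

lemma has_laplacian_add:
  assumes "has_laplacian w x L" "has_laplacian v x M"
  shows "has_laplacian (\<lambda>y. w y + v y) x (L + M)"
proof -
  obtain p q where 1: "\<And>b. b \<in> Basis \<Longrightarrow> has_second_deriv (\<lambda>t. w (x + t *\<^sub>R b)) 0 (p b) (q b)" "L = sum q Basis"
    using assms(1) unfolding has_laplacian_def by blast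
  obtain p' q' where 2: "\<And>b. b \<in> Basis \<Longrightarrow> has_second_deriv (\<lambda>t. v (x + t *\<^sub>R b)) 0 (p' b) (q' b)" "M = sum q' Basis"
    using assms(2) unfolding has_laplacian_def by blast
  show ?thesis
    by (rule has_laplacianI[where p = "\<lambda>b. p b + p' b" and q = "\<lambda>b. q b + q' b"])
       (auto intro: has_second_deriv_add 1 2 simp: sum.distrib 1(2) 2(2))
qed

lemma has_laplacian_cmult:
  assumes "has_laplacian w x L"
  shows "has_laplacian (\<lambda>y. c * w y) x (c * L)"
proof -
  obtain p q where 1: "\<And>b. b \<in> Basis \<Longrightarrow> has_second_deriv (\<lambda>t. w (x + t *\<^sub>R b)) 0 (p b) (q b)" "L = sum q Basis"
    using assms(1) unfolding has_laplacian_def by blast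
  show ?thesis
    by (rule has_laplacianI[where p = "\<lambda>b. c * p b" and q = "\<lambda>b. c * q b"])
       (auto intro: has_second_deriv_cmult 1 simp: sum_distrib_left 1(2))
qed

lemma has_laplacian_diff:
  assumes "has_laplacian w x L" "has_laplacian v x M"
  shows "has_laplacian (\<lambda>y. w y - v y) x (L - M)"
  using has_laplacian_add[OF assms(1) has_laplacian_cmult[OF assms(2), of "-1"]] by simp

lemma has_laplacian_local_min:
  assumes "has_laplacian w x L" "\<forall>\<^sub>F y in nhds x. w x \<le> w y"
  shows "L \<ge> 0"
proof -
  obtain p q where 1: "\<And>b. b \<in> Basis \<Longrightarrow> has_second_deriv (\<lambda>t. w (x + t *\<^sub>R b)) 0 (p b) (q b)" "L = sum q Basis"
    using assms(1) unfolding has_laplacian_def by blast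
  have "q b \<ge> 0" if "b \<in> Basis" for b
  proof (rule has_second_deriv_local_min(2)[OF 1(1)[OF that]])
    have "isCont (\<lambda>t. x + t *\<^sub>R b) 0"
      by (intro continuous_intros)
    then have "((\<lambda>t. x + t *\<^sub>R b) \<longlongrightarrow> x + 0 *\<^sub>R b) (nhds 0)"
      using tendsto_at_iff_tendsto_nhds[of "\<lambda>t. x + t *\<^sub>R b" 0] by (simp add: isCont_def)
    then show "\<forall>\<^sub>F s in nhds 0. w (x + 0 *\<^sub>R b) \<le> w (x + s *\<^sub>R b)"
      using eventually_compose_filterlim[OF assms(2)] by simp
  qed
  then show ?thesis by (simp add: 1(2) sum_nonneg)
qed

section \<open>Laplacians of the auxiliary functions in the comparison arguments\<close>

lemma has_laplacian_norm_square:
  "has_laplacian (\<lambda>y::'a::euclidean_space. (norm y)\<^sup>2) x (2 * DIM('a))"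
proof (rule has_laplacianI[where p = "\<lambda>b. 2 * (x \<bullet> b)" and q = "\<lambda>b. 2"])
  fix b :: 'a assume b: "b \<in> Basis"
  have eq: "(norm (x + t *\<^sub>R b))\<^sup>2 = (norm x)\<^sup>2 + 2 * t * (x \<bullet> b) + t\<^sup>2" for t
    unfolding power2_norm_eq_inner using b
    by (simp add: inner_simps inner_commute power2_eq_square algebra_simps)
  show "has_second_deriv (\<lambda>t. (norm (x + t *\<^sub>R b))\<^sup>2) 0 (2 * (x \<bullet> b)) 2"
    unfolding eq
    by (rule has_second_derivI[where S = UNIV and g' = "\<lambda>t. 2 * (x \<bullet> b) + 2 * t"])
       (auto intro!: derivative_eq_intros)
qed simp

lemma has_laplacian_inner_square:
  fixes e :: "'a::euclidean_space"
  assumes "norm e = 1"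
  shows "has_laplacian (\<lambda>y. (y \<bullet> e - l)\<^sup>2) x 2"
proof (rule has_laplacianI[where p = "\<lambda>b. 2 * (x \<bullet> e - l) * (b \<bullet> e)" and q = "\<lambda>b. 2 * (b \<bullet> e)\<^sup>2"])
  fix b :: 'a assume b: "b \<in> Basis"
  show "has_second_deriv (\<lambda>t. ((x + t *\<^sub>R b) \<bullet> e - l)\<^sup>2) 0 (2 * (x \<bullet> e - l) * (b \<bullet> e)) (2 * (b \<bullet> e)\<^sup>2)"
    by (rule has_second_derivI[where S = UNIV and g' = "\<lambda>t. 2 * (x \<bullet> e + t * (b \<bullet> e) - l) * (b \<bullet> e)"])
       (auto intro!: derivative_eq_intros simp: inner_simps power2_eq_square)
next
  have "(\<Sum>b\<in>Basis. (b \<bullet> e)\<^sup>2) = e \<bullet> e"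
    unfolding euclidean_inner[of e e] by (simp add: inner_commute power2_eq_square)
  then show "(\<Sum>b\<in>Basis. 2 * (b \<bullet> e)\<^sup>2) = 2"
    using assms by (simp flip: sum_distrib_left add: dot_square_norm)
qed

lemma has_laplacian_gaussian:
  fixes x c :: "'a::euclidean_space"
  shows "has_laplacian (\<lambda>y. exp (- k * (norm (y - c))\<^sup>2)) x
    ((4 * k\<^sup>2 * (norm (x - c))\<^sup>2 - 2 * k * DIM('a)) * exp (- k * (norm (x - c))\<^sup>2))"
proof (rule has_laplacianI[where p = "\<lambda>b. - 2 * k * ((x - c) \<bullet> b) * exp (- k * (norm (x - c))\<^sup>2)"
      and q = "\<lambda>b. (4 * k\<^sup>2 * ((x - c) \<bullet> b)\<^sup>2 - 2 * k) * exp (- k * (norm (x - c))\<^sup>2)"])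
  fix b :: 'a assume b: "b \<in> Basis"
  define z where "z = x - c"
  have eq: "(norm (x + t *\<^sub>R b - c))\<^sup>2 = (norm z)\<^sup>2 + 2 * t * (z \<bullet> b) + t\<^sup>2" for t
  proof -
    have "x + t *\<^sub>R b - c = z + t *\<^sub>R b" by (simp add: z_def)
    then show ?thesis
      unfolding power2_norm_eq_inner using b
    by (simp add: inner_simps inner_commute power2_eq_square algebra_simps)
  qed
  show "has_second_deriv (\<lambda>t. exp (- k * (norm (x + t *\<^sub>R b - c))\<^sup>2)) 0
     (- 2 * k * ((x - c) \<bullet> b) * exp (- k * (norm (x - c))\<^sup>2))
     ((4 * k\<^sup>2 * ((x - c) \<bullet> b)\<^sup>2 - 2 * k) * exp (- k * (norm (x - c))\<^sup>2))"
    unfolding eq z_def[symmetric]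
    by (rule has_second_derivI[where S = UNIV and
         g' = "\<lambda>t. - 2 * k * (z \<bullet> b + t) * exp (- k * ((norm z)\<^sup>2 + 2 * t * (z \<bullet> b) + t\<^sup>2))"])
       (auto intro!: derivative_eq_intros simp: power2_eq_square algebra_simps)
next
  have "(\<Sum>b\<in>Basis. ((x - c) \<bullet> b)\<^sup>2) = (norm (x - c))\<^sup>2"
    unfolding power2_norm_eq_inner euclidean_inner[of "x - c" "x - c"] by (simp add: power2_eq_square)
  then show "(\<Sum>b\<in>Basis. (4 * k\<^sup>2 * ((x - c) \<bullet> b)\<^sup>2 - 2 * k) * exp (- k * (norm (x - c))\<^sup>2)) =
      (4 * k\<^sup>2 * (norm (x - c))\<^sup>2 - 2 * k * DIM('a)) * exp (- k * (norm (x - c))\<^sup>2)"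
    by (simp flip: sum_distrib_left sum_distrib_right add: sum_subtractf)
qed

lemma has_laplacian_const: "has_laplacian (\<lambda>y. c) x 0"
  by (rule has_laplacianI[where p = "\<lambda>b. 0" and q = "\<lambda>b. 0"])
     (auto intro!: has_second_derivI[where S = UNIV and g' = "\<lambda>t. 0"])

section \<open>A local strong minimum principle\<close>

text \<open>The barrier is a Gaussian centred at \<open>c\<close>.\<close>

lemma positive_on_ball:
  fixes w L :: "'a::euclidean_space \<Rightarrow> real"
  assumes cont: "continuous_on (cball c R) w"
    and lap: "\<And>x. x \<in> ball c R \<Longrightarrow> has_laplacian w x (L x)"
    and le: "\<And>x. x \<in> ball c R \<Longrightarrow> L x \<le> C * w x"
    and nonneg: "\<And>x. x \<in> cball c R \<Longrightarrow> w x \<ge> 0"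
    and pos: "w c > 0" and C: "C \<ge> 0" and x: "x \<in> ball c R"
  shows "w x > 0"
proof -
  have R: "R > 0" using x by (auto intro: le_less_trans[OF zero_le_dist])
  define \<epsilon> where "\<epsilon> = w c / 2"
  have \<epsilon>: "\<epsilon> > 0" using pos by (simp add: \<epsilon>_def)
  obtain d where d: "d > 0" "\<And>y. y \<in> cball c R \<Longrightarrow> dist y c < d \<Longrightarrow> dist (w y) (w c) < \<epsilon>"
    using cont \<epsilon> R unfolding continuous_on_iff by (metis centre_in_cball less_imp_le)
  define \<rho> where "\<rho> = min d R / 2"
  have \<rho>: "0 < \<rho>" "\<rho> < R" "\<rho> < d" using d(1) R by (auto simp: \<rho>_def)
  have near: "w y > \<epsilon>" if "dist y c \<le> \<rho>" for y
    using d(2)[of y] that \<rho> by (auto simp: dist_commute dist_real_def \<epsilon>_def abs_if split: if_splits)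
  define n where "n = real DIM('a)"
  have n: "n \<ge> 1" by (simp add: n_def Suc_leI)
  \<comment> \<open>\<open>k\<close> is so large that at distance at least \<open>\<rho>\<close>
    from the centre the Laplacian of the Gaussian exceeds \<open>C\<close> times the Gaussian; this
    is \<open>kk\<close>.\<close>
  define k where "k = (C + 1 + 2 * n) / (4 * \<rho>\<^sup>2) + 1"
  have k: "k \<ge> 1" using C n by (auto simp: k_def)
  have kk: "4 * k\<^sup>2 * s\<^sup>2 - 2 * k * n > C" if "s \<ge> \<rho>" for s
  proof -
    have "4 * \<rho>\<^sup>2 * k = C + 1 + 2 * n + 4 * \<rho>\<^sup>2"
      using \<rho>(1) by (simp add: k_def field_simps)
    then have A: "4 * \<rho>\<^sup>2 * k \<ge> C + 1 + 2 * n" using \<rho> by simp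
    have "\<rho>\<^sup>2 \<le> s\<^sup>2" using that \<rho> by (intro power_mono) auto
    then have "4 * k * \<rho>\<^sup>2 \<le> 4 * k * s\<^sup>2" using k by (intro mult_left_mono) auto
    with A have "4 * k * s\<^sup>2 - 2 * n \<ge> C + 1" by (simp add: algebra_simps)
    then have "k * (4 * k * s\<^sup>2 - 2 * n) \<ge> 1 * (C + 1)"
      using k C by (intro mult_mono) auto
    then show ?thesis by (simp add: power2_eq_square algebra_simps)
  qed
  define h where "h = (\<lambda>y. exp (- k * (norm (y - c))\<^sup>2) - exp (- k * R\<^sup>2))"
  have h1: "h y \<le> 1" for y
  proof -
    have "exp (- k * (norm (y - c))\<^sup>2) \<le> 1" using k by simp
    then show ?thesis unfolding h_def by (smt (verit) exp_gt_zero)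
  qed
  \<comment> \<open>On the annulus \<open>A\<close> the barrier \<open>\<epsilon> * h\<close> lies
    below \<open>w\<close> on the inner sphere, where \<open>w > \<epsilon>\<close> and
    \<open>h \<le> 1\<close>, and vanishes on the outer one. A negative minimum of \<open>v\<close>
    would be interior, where the Laplacian of \<open>v\<close> would be negative.\<close>
  define v where "v = (\<lambda>y. w y - \<epsilon> * h y)"
  define A where "A = cball c R - ball c \<rho>"
  have A: "compact A" unfolding A_def by (intro compact_diff) auto
  have cv: "continuous_on A v"
    unfolding v_def h_def A_def
    by (intro continuous_intros continuous_on_subset[OF cont]) auto
  show ?thesis
  proof (cases "dist x c \<le> \<rho>")
    case True then show ?thesis using near \<epsilon> by force
  next
    case False
    then have xA: "x \<in> A" using x by (auto simp: A_def dist_commute)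
    then obtain z where z: "z \<in> A" "\<And>y. y \<in> A \<Longrightarrow> v z \<le> v y"
      using continuous_attains_inf[OF A _ cv] by blast
    have "v z \<ge> 0"
    proof (rule ccontr)
      assume "\<not> v z \<ge> 0"
      then have neg: "w z < \<epsilon> * h z" by (simp add: v_def)
      have "dist z c \<noteq> \<rho>"
      proof
        assume "dist z c = \<rho>"
        then have "w z > \<epsilon>" using near by simp
        moreover have "\<epsilon> * h z \<le> \<epsilon>" using mult_left_mono[OF h1[of z]] \<epsilon> by force
        ultimately show False using neg by simp
      qed
      moreover have "dist z c \<noteq> R"
      proof
        assume "dist z c = R"
        then have "h z = 0" by (simp add: h_def dist_norm)
        then show False using neg nonneg[of z] z(1) by (auto simp: A_def)
      qed
      ultimately have zi: "z \<in> ball c R - cball c \<rho>" using z(1) by (auto simp: A_def dist_commute)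
      have mn: "\<forall>\<^sub>F y in nhds z. v z \<le> v y"
        by (rule eventually_mono[OF eventually_nhds_in_open[of "ball c R - cball c \<rho>"]])
           (use zi z(2) in \<open>auto simp: A_def\<close>)
      have "has_laplacian v z (L z - \<epsilon> * ((4 * k\<^sup>2 * (norm (z - c))\<^sup>2 - 2 * k * DIM('a)) * exp (- k * (norm (z - c))\<^sup>2) - 0))"
        unfolding v_def h_def
        by (intro has_laplacian_diff has_laplacian_cmult has_laplacian_gaussian has_laplacian_const lap) (use zi in auto)
      from has_laplacian_local_min[OF this mn]
      have "L z - \<epsilon> * ((4 * k\<^sup>2 * (norm (z - c))\<^sup>2 - 2 * k * n) * exp (- k * (norm (z - c))\<^sup>2)) \<ge> 0"
        by (simp add: n_def)
      moreover have "L z \<le> C * (\<epsilon> * h z)"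
        using le[of z] zi neg C mult_left_mono[of "w z" "\<epsilon> * h z" C] by auto
      moreover have "C * (\<epsilon> * h z) \<le> \<epsilon> * (C * exp (- k * (norm (z - c))\<^sup>2))"
        using C \<epsilon> by (simp add: h_def algebra_simps)
      moreover have "\<epsilon> * (C * exp (- k * (norm (z - c))\<^sup>2)) < \<epsilon> * ((4 * k\<^sup>2 * (norm (z - c))\<^sup>2 - 2 * k * n) * exp (- k * (norm (z - c))\<^sup>2))"
        using kk[of "norm (z - c)"] zi \<epsilon> by (auto simp: dist_norm norm_minus_commute)
      ultimately show False by linarith
    qed
    then have "v x \<ge> 0" using z(2)[OF xA] by simp
    moreover have "h x > 0"
    proof -
      have "norm (x - c) < R" using x by (simp add: dist_norm norm_minus_commute)
      then have "(norm (x - c))\<^sup>2 < R\<^sup>2" by (intro power_strict_mono) auto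
      then show ?thesis using k by (simp add: h_def)
    qed
    then have "\<epsilon> * h x > 0" using \<epsilon> by simp
    ultimately show ?thesis by (simp add: v_def)
  qed
qed

section \<open>The Laplacian at extrema on spheres\<close>

text \<open>Second-order chain rule. For a great circle the acceleration term
  \<open>Du (\<gamma> t) \<gamma>''\<close> records the curvature of the sphere; for a straight line
  it vanishes.\<close>

lemma has_second_deriv_curve:
  fixes u :: "'a::euclidean_space \<Rightarrow> real"
  assumes S: "open S" "\<gamma> t \<in> S"
    and Du: "\<And>x. x \<in> S \<Longrightarrow> (u has_derivative blinfun_apply (Du x)) (at x)"
    and D2u: "\<And>x. x \<in> S \<Longrightarrow> (Du has_derivative blinfun_apply (D2u x)) (at x)"
    and \<gamma>: "\<And>s. (\<gamma> has_vector_derivative \<gamma>' s) (at s)" "(\<gamma>' has_vector_derivative \<gamma>'') (at t)"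
  shows "has_second_deriv (\<lambda>s. u (\<gamma> s)) t (Du (\<gamma> t) (\<gamma>' t)) (D2u (\<gamma> t) (\<gamma>' t) (\<gamma>' t) + Du (\<gamma> t) \<gamma>'')"
proof (rule has_second_derivI[where S = "\<gamma> -` S" and g' = "\<lambda>s. Du (\<gamma> s) (\<gamma>' s)"])
  have "continuous_on UNIV \<gamma>"
    using \<gamma>(1) by (auto intro!: continuous_at_imp_continuous_on has_vector_derivative_continuous)
  then show "open (\<gamma> -` S)" using S(1) by (rule open_vimage[rotated])
  show "t \<in> \<gamma> -` S" using S by simp
  show "((\<lambda>s. u (\<gamma> s)) has_real_derivative Du (\<gamma> s) (\<gamma>' s)) (at s)" if "s \<in> \<gamma> -` S" for s
  proof -
    have "((\<lambda>s. u (\<gamma> s)) has_derivative (\<lambda>h. Du (\<gamma> s) (h *\<^sub>R \<gamma>' s))) (at s)"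
      using has_derivative_compose[OF \<gamma>(1)[of s, unfolded has_vector_derivative_def] Du] that by simp
    then show ?thesis
      by (simp add: has_field_derivative_def blinfun.scaleR_right mult_commute_abs)
  qed
  have A: "((\<lambda>s. Du (\<gamma> s)) has_derivative (\<lambda>h. D2u (\<gamma> t) (h *\<^sub>R \<gamma>' t))) (at t)"
    using has_derivative_compose[OF \<gamma>(1)[of t, unfolded has_vector_derivative_def] D2u] S by simp
  have "((\<lambda>s. Du (\<gamma> s) (\<gamma>' s)) has_derivative
      (\<lambda>h. Du (\<gamma> t) (h *\<^sub>R \<gamma>'') + D2u (\<gamma> t) (h *\<^sub>R \<gamma>' t) (\<gamma>' t))) (at t)"
    by (rule bounded_bilinear.FDERIV[OF bounded_bilinear_blinfun_apply A
          \<gamma>(2)[unfolded has_vector_derivative_def]])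
  then show "((\<lambda>s. Du (\<gamma> s) (\<gamma>' s)) has_real_derivative
      D2u (\<gamma> t) (\<gamma>' t) (\<gamma>' t) + Du (\<gamma> t) \<gamma>'') (at t)"
    unfolding has_field_derivative_def
    by (rule has_derivative_eq_rhs)
       (auto simp: fun_eq_iff blinfun.scaleR_right blinfun.scaleR_left algebra_simps)
qed simp

lemma has_second_deriv_line:
  fixes u :: "'a::euclidean_space \<Rightarrow> real"
  assumes S: "open S" "x + t *\<^sub>R v \<in> S"
    and Du: "\<And>x. x \<in> S \<Longrightarrow> (u has_derivative blinfun_apply (Du x)) (at x)"
    and D2u: "\<And>x. x \<in> S \<Longrightarrow> (Du has_derivative blinfun_apply (D2u x)) (at x)"
  shows "has_second_deriv (\<lambda>s. u (x + s *\<^sub>R v)) t (Du (x + t *\<^sub>R v) v) (D2u (x + t *\<^sub>R v) v v)"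
proof -
  have 1: "((\<lambda>s. x + s *\<^sub>R v) has_vector_derivative v) (at s)" for s
    by (auto intro!: derivative_eq_intros)
  show ?thesis
    using has_second_deriv_curve[OF S(1), of "\<lambda>s. x + s *\<^sub>R v" t u Du D2u "\<lambda>s. v" 0] S(2) Du D2u 1
    by (simp add: blinfun.zero_right)
qed

text \<open>The projections \<open>\<tau> b\<close> of the standard basis stand in for an
  orthonormal basis of the hyperplane orthogonal to \<open>\<omega>\<close>: summing over them gives
  the trace on that hyperplane, which has dimension \<open>DIM('a) - 1\<close>.\<close>

lemma trace_normal_tangential:
  fixes T :: "'a::euclidean_space \<Rightarrow>\<^sub>L 'a \<Rightarrow>\<^sub>L real" and \<omega> :: 'a
  defines "\<tau> \<equiv> \<lambda>b. b - (b \<bullet> \<omega>) *\<^sub>R \<omega>"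
  assumes "norm \<omega> = 1"
  shows "(\<Sum>b\<in>Basis. T b b) = T \<omega> \<omega> + (\<Sum>b\<in>Basis. T (\<tau> b) (\<tau> b))"
    and "(\<Sum>b\<in>Basis. (norm (\<tau> b))\<^sup>2) = real DIM('a) - 1"
proof -
  have oo: "\<omega> \<bullet> \<omega> = 1" using assms by (simp add: dot_square_norm)
  have sq: "(\<Sum>b\<in>Basis. (b \<bullet> \<omega>) * (b \<bullet> \<omega>)) = 1"
    using oo unfolding euclidean_inner[of \<omega> \<omega>] by (simp add: inner_commute)
  have rep: "(\<Sum>b\<in>Basis. (b \<bullet> \<omega>) *\<^sub>R b) = \<omega>"
    using euclidean_representation[of \<omega>] by (simp add: inner_commute)
  have "(\<Sum>b\<in>Basis. T b b) = (\<Sum>b\<in>Basis. T (\<tau> b) (\<tau> b) + T ((b \<bullet> \<omega>) *\<^sub>R b) \<omega>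
      + T \<omega> ((b \<bullet> \<omega>) *\<^sub>R b) - (b \<bullet> \<omega>) * (b \<bullet> \<omega>) * T \<omega> \<omega>)"
    by (rule sum.cong)
       (auto simp: \<tau>_def blinfun.diff_left blinfun.diff_right blinfun.scaleR_left
          blinfun.scaleR_right algebra_simps)
  also have "\<dots> = (\<Sum>b\<in>Basis. T (\<tau> b) (\<tau> b)) + T (\<Sum>b\<in>Basis. (b \<bullet> \<omega>) *\<^sub>R b) \<omega>
      + T \<omega> (\<Sum>b\<in>Basis. (b \<bullet> \<omega>) *\<^sub>R b) - (\<Sum>b\<in>Basis. (b \<bullet> \<omega>) * (b \<bullet> \<omega>)) * T \<omega> \<omega>"
    by (simp add: sum.distrib sum_subtractf blinfun.sum_left blinfun.sum_right sum_distrib_right)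
  finally show "(\<Sum>b\<in>Basis. T b b) = T \<omega> \<omega> + (\<Sum>b\<in>Basis. T (\<tau> b) (\<tau> b))"
    by (simp add: sq rep)
  have "(norm (\<tau> b))\<^sup>2 = 1 - (b \<bullet> \<omega>) * (b \<bullet> \<omega>)" if "b \<in> Basis" for b
    using that oo unfolding power2_norm_eq_inner \<tau>_def
    by (simp add: inner_simps inner_commute algebra_simps)
  then show "(\<Sum>b\<in>Basis. (norm (\<tau> b))\<^sup>2) = real DIM('a) - 1"
    using sq by (simp add: sum_subtractf of_nat_diff Suc_leI)
qed

text \<open>Along every great circle through \<open>y\<close> the function has a maximum at
  \<open>y\<close>, so each tangential second derivative is at most the radial derivative divided by
  the radius. The \<open>DIM('a) - 1\<close> tangential directions add up to the first-order term of
  the polar Laplacian.\<close>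

lemma laplacian_le_at_sphere_max:
  fixes u :: "'a::euclidean_space \<Rightarrow> real"
  assumes S: "open S" "y \<in> S" and y: "y \<noteq> 0"
    and Du: "\<And>x. x \<in> S \<Longrightarrow> (u has_derivative blinfun_apply (Du x)) (at x)"
    and D2u: "\<And>x. x \<in> S \<Longrightarrow> (Du has_derivative blinfun_apply (D2u x)) (at x)"
    and max: "\<And>z. norm z = norm y \<Longrightarrow> u z \<le> u y"
  shows "(\<Sum>b\<in>Basis. D2u y b b) \<le>
    D2u y (sgn y) (sgn y) + (real DIM('a) - 1) / norm y * Du y (sgn y)"
proof -
  define \<omega> where "\<omega> = sgn y"
  define l where "l = norm y"
  have l: "l > 0" using y by (simp add: l_def)
  have \<omega>: "norm \<omega> = 1" "\<omega> \<bullet> \<omega> = 1" "y = l *\<^sub>R \<omega>"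
    using y by (auto simp: \<omega>_def norm_sgn l_def sgn_div_norm dot_square_norm)
  define \<tau> where "\<tau> = (\<lambda>b. b - (b \<bullet> \<omega>) *\<^sub>R \<omega>)"
  have unit: "D2u y e e \<le> Du y \<omega> / l" if e: "norm e = 1" "e \<bullet> \<omega> = 0" for e
  proof -
    \<comment> \<open>The great circle through \<open>y\<close> in direction \<open>e\<close>; its
      acceleration at 0 is \<open>- y\<close>, which produces the term
      \<open>Du y (- y)\<close>.\<close>
    define \<gamma> where "\<gamma> = (\<lambda>t. cos t *\<^sub>R y + sin t *\<^sub>R (l *\<^sub>R e))"
    define \<gamma>' where "\<gamma>' = (\<lambda>t. (- sin t) *\<^sub>R y + cos t *\<^sub>R (l *\<^sub>R e))"
    have ee: "e \<bullet> e = 1" using e by (simp add: dot_square_norm)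
    have "\<gamma> t \<bullet> \<gamma> t = l\<^sup>2 * (cos t)\<^sup>2 + l\<^sup>2 * (sin t)\<^sup>2" for t
      using e(2) \<omega>(2) ee unfolding \<gamma>_def \<omega>(3)
      by (simp add: inner_simps inner_commute algebra_simps power2_eq_square)
    then have "\<gamma> t \<bullet> \<gamma> t = l\<^sup>2" for t
      by (simp flip: distrib_left)
    then have "norm (\<gamma> t) = norm y" for t
      using l by (simp add: norm_eq_sqrt_inner[of "\<gamma> t"] l_def)
    then have le: "u (\<gamma> t) \<le> u y" for t using max by blast
    have 1: "(\<gamma> has_vector_derivative \<gamma>' s) (at s)" for s
      unfolding \<gamma>_def \<gamma>'_def by (auto intro!: derivative_eq_intros)
    have 2: "(\<gamma>' has_vector_derivative (- y)) (at 0)"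
      unfolding \<gamma>'_def by (auto intro!: derivative_eq_intros)
    have [simp]: "\<gamma> 0 = y" "\<gamma>' 0 = l *\<^sub>R e" by (auto simp: \<gamma>_def \<gamma>'_def)
    have "has_second_deriv (\<lambda>s. u (\<gamma> s)) 0 (Du y (l *\<^sub>R e)) (D2u y (l *\<^sub>R e) (l *\<^sub>R e) + Du y (- y))"
      using has_second_deriv_curve[OF S(1), of \<gamma> 0 u Du D2u \<gamma>' "- y"] S(2) Du D2u 1 2 by simp
    from has_second_deriv_local_min(2)[OF has_second_deriv_cmult[OF this, of "-1"]]
    have "l * (l * D2u y e e) \<le> l * Du y \<omega>"
      using le by (simp add: blinfun.scaleR_left blinfun.scaleR_right blinfun.minus_right)
         (simp add: \<omega>(3) blinfun.scaleR_right)
    then show ?thesis using l by (simp add: field_simps)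
  qed
  have tan: "D2u y (\<tau> b) (\<tau> b) \<le> (norm (\<tau> b))\<^sup>2 * (Du y \<omega> / l)" for b
  proof (cases "\<tau> b = 0")
    case False
    have "\<tau> b \<bullet> \<omega> = 0" using \<omega> by (simp add: \<tau>_def inner_simps)
    then have "D2u y (sgn (\<tau> b)) (sgn (\<tau> b)) \<le> Du y \<omega> / l"
      using False by (intro unit) (auto simp: norm_sgn sgn_div_norm)
    then have "(norm (\<tau> b))\<^sup>2 * D2u y (sgn (\<tau> b)) (sgn (\<tau> b)) \<le> (norm (\<tau> b))\<^sup>2 * (Du y \<omega> / l)"
      by (intro mult_left_mono) auto
    moreover have "(norm (\<tau> b))\<^sup>2 * D2u y (sgn (\<tau> b)) (sgn (\<tau> b)) = D2u y (\<tau> b) (\<tau> b)"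
      using False by (simp add: sgn_div_norm blinfun.scaleR_left blinfun.scaleR_right power2_eq_square field_simps)
    ultimately show ?thesis by simp
  qed (simp add: blinfun.zero_left)
  have "(\<Sum>b\<in>Basis. D2u y b b) = D2u y \<omega> \<omega> + (\<Sum>b\<in>Basis. D2u y (\<tau> b) (\<tau> b))"
    unfolding \<tau>_def by (rule trace_normal_tangential(1)[OF \<omega>(1)])
  also have "\<dots> \<le> D2u y \<omega> \<omega> + (\<Sum>b\<in>Basis. (norm (\<tau> b))\<^sup>2 * (Du y \<omega> / l))"
    by (intro add_left_mono sum_mono tan)
  also have "\<dots> = D2u y \<omega> \<omega> + (real DIM('a) - 1) / l * Du y \<omega>"
    unfolding sum_distrib_right[symmetric] \<tau>_def trace_normal_tangential(2)[OF \<omega>(1)] by simp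
  finally show ?thesis by (simp add: \<omega>_def l_def)
qed

lemma laplacian_ge_at_sphere_min:
  fixes u :: "'a::euclidean_space \<Rightarrow> real"
  assumes S: "open S" "y \<in> S" and y: "y \<noteq> 0"
    and Du: "\<And>x. x \<in> S \<Longrightarrow> (u has_derivative blinfun_apply (Du x)) (at x)"
    and D2u: "\<And>x. x \<in> S \<Longrightarrow> (Du has_derivative blinfun_apply (D2u x)) (at x)"
    and min: "\<And>z. norm z = norm y \<Longrightarrow> u y \<le> u z"
  shows "D2u y (sgn y) (sgn y) + (real DIM('a) - 1) / norm y * Du y (sgn y) \<le>
    (\<Sum>b\<in>Basis. D2u y b b)"
proof -
  have 1: "((\<lambda>x. - u x) has_derivative blinfun_apply (- Du x)) (at x)" if "x \<in> S" for x
    using has_derivative_minus[OF Du[OF that]] by (simp add: blinfun.minus_left[abs_def] uminus_blinfun.rep_eq)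
  have 2: "((\<lambda>x. - Du x) has_derivative blinfun_apply (- D2u x)) (at x)" if "x \<in> S" for x
    using has_derivative_minus[OF D2u[OF that]] by (simp add: uminus_blinfun.rep_eq)
  show ?thesis
    using laplacian_le_at_sphere_max[OF S y 1 2] min
    by (simp add: blinfun.minus_left sum_negf)
qed

section \<open>Large solutions near the boundary\<close>

lemma continuous_on_compact_abs_bound:
  fixes g :: "'a::metric_space \<Rightarrow> real"
  assumes "compact S" "continuous_on S g"
  shows "\<exists>c. \<forall>x\<in>S. \<bar>g x\<bar> \<le> c"
  using compact_imp_bounded[OF compact_continuous_image[OF assms(2,1)]] by (simp add: bounded_iff)

text \<open>The derivatives are parameters, so the equation becomes a trace identity and radial
  derivatives are evaluations of \<open>Du\<close> and \<open>D2u\<close>. \<open>K\<close> stands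
  for the absolute value of the constant in the theorem; passing to it keeps
  \<open>f t + K * t\<close> nondecreasing.\<close>

locale large_ball_solution =
  fixes f :: "real \<Rightarrow> real" and a K :: real and u :: "'a::euclidean_space \<Rightarrow> real"
    and Du :: "'a \<Rightarrow> 'a \<Rightarrow>\<^sub>L real" and D2u :: "'a \<Rightarrow> 'a \<Rightarrow>\<^sub>L 'a \<Rightarrow>\<^sub>L real"
  assumes Du: "\<And>x. norm x < 1 \<Longrightarrow> (u has_derivative blinfun_apply (Du x)) (at x)"
    and D2u: "\<And>x. norm x < 1 \<Longrightarrow> (Du has_derivative blinfun_apply (D2u x)) (at x)"
    and trace_D2u: "\<And>x. norm x < 1 \<Longrightarrow> (\<Sum>b\<in>Basis. D2u x b b) = f (u x)"
    and blow_up: "\<And>x. norm x = 1 \<Longrightarrow> filterlim u at_top (at x within ball 0 1)"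
    and f_nonneg: "\<And>t. t > a \<Longrightarrow> f t \<ge> 0"
    and f_quasimono: "\<And>s t. s \<le> t \<Longrightarrow> f s + K * s \<le> f t + K * t"
    and K_nonneg: "K \<ge> 0"
    and f_lipschitz: "\<And>c. \<exists>L. L-lipschitz_on {-c..c} f"
begin

lemma isCont_u: "norm x < 1 \<Longrightarrow> isCont u x"
  using Du has_derivative_continuous by blast

lemma continuous_on_u: "S \<subseteq> ball 0 1 \<Longrightarrow> continuous_on S u"
  by (auto intro!: continuous_at_imp_continuous_on isCont_u)

lemma bounded_on_cball:
  assumes "r < 1"
  obtains C where "C \<ge> 0" "\<And>x. norm x \<le> r \<Longrightarrow> \<bar>u x\<bar> \<le> C"
proof -
  have "bounded (u ` cball 0 r)"
    using assms by (intro compact_imp_bounded compact_continuous_image continuous_on_u) auto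
  then obtain C where "\<And>x. norm x \<le> r \<Longrightarrow> \<bar>u x\<bar> \<le> C"
    unfolding bounded_iff by force
  then show ?thesis by (intro that[of "\<bar>C\<bar>"]) force+
qed

text \<open>Compactness makes the blow-up uniform: points with \<open>u \<le> C\<close> and norms
  tending to 1 would accumulate at a point of the unit sphere, where \<open>u\<close> tends to
  infinity.\<close>

lemma large_near_sphere:
  obtains r where "0 < r" "r < 1" "\<And>x. r \<le> norm x \<Longrightarrow> norm x < 1 \<Longrightarrow> u x > C"
proof -
  have "\<exists>n::nat. \<forall>x. 1 - inverse (real (Suc n)) \<le> norm x \<and> norm x < 1 \<longrightarrow> u x > C"
  proof (rule ccontr)
    assume "\<not> ?thesis"
    then obtain X :: "nat \<Rightarrow> 'a" where X: "\<And>n. 1 - inverse (real (Suc n)) \<le> norm (X n)" "\<And>n. norm (X n) < 1" "\<And>n. u (X n) \<le> C"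
      unfolding not_ex not_all not_imp not_less by metis
    have "bounded (range X)"
      using X(2) by (intro boundedI[of _ 1]) (auto intro: less_imp_le)
    then obtain l \<sigma> where l: "strict_mono \<sigma>" "(X \<circ> \<sigma>) \<longlonglongrightarrow> l"
      using bounded_imp_convergent_subsequence by blast
    have "(\<lambda>n. 1 - inverse (real (Suc (\<sigma> n)))) \<longlonglongrightarrow> 1"
      using LIMSEQ_subseq_LIMSEQ[OF LIMSEQ_inverse_real_of_nat_add_minus[of 1] l(1)] by (simp add: o_def)
    then have "(\<lambda>n. norm ((X \<circ> \<sigma>) n)) \<longlonglongrightarrow> 1"
      by (rule tendsto_sandwich[rotated 2, OF _ tendsto_const[of 1]])
         (auto intro!: always_eventually less_imp_le[OF X(2)] X(1)[of "\<sigma> _", simplified])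
    then have nl: "norm l = 1"
      using LIMSEQ_unique[OF tendsto_norm[OF l(2)]] by blast
    have "filterlim (X \<circ> \<sigma>) (at l within ball 0 1) sequentially"
    proof -
      have "X n \<noteq> l" for n using X(2)[of n] nl by auto
      then show ?thesis
        unfolding filterlim_at using l(2) X(2) by (auto intro!: always_eventually)
    qed
    from filterlim_compose[OF blow_up[OF nl] this]
    have "\<forall>\<^sub>F n in sequentially. u ((X \<circ> \<sigma>) n) > C"
      unfolding filterlim_at_top_dense by blast
    then obtain n where "u (X (\<sigma> n)) > C" unfolding eventually_sequentially by auto
    then show False using X(3)[of "\<sigma> n"] by simp
  qed
  then obtain n :: nat where "\<And>x. 1 - inverse (real (Suc n)) \<le> norm x \<Longrightarrow> norm x < 1 \<Longrightarrow> u x > C" by blast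
  \<comment> \<open>For \<open>n = 0\<close> the radius found is 0; the maximum with
    \<open>1/2\<close> keeps it positive.\<close>
  then show ?thesis by (intro that[of "max (1/2) (1 - inverse (real (Suc n)))"]) auto
qed

lemma has_laplacian_u:
  assumes "norm x < 1"
  shows "has_laplacian u x (f (u x))"
proof (rule has_laplacianI)
  show "has_second_deriv (\<lambda>t. u (x + t *\<^sub>R b)) 0 (Du x b) (D2u x b b)" for b
    using has_second_deriv_line[OF open_ball[of 0 1], of x 0 b u Du D2u] assms Du D2u by simp
qed (rule trace_D2u[OF assms])

definition u_r :: "'a \<Rightarrow> real" where "u_r x = Du x (sgn x)"
definition u_rr :: "'a \<Rightarrow> real" where "u_rr x = D2u x (sgn x) (sgn x)"

lemma has_second_deriv_radial:
  assumes "norm x < 1" "x \<noteq> 0"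
  shows "has_second_deriv (\<lambda>r. u (r *\<^sub>R sgn x)) (norm x) (u_r x) (u_rr x)"
proof -
  have "norm x *\<^sub>R sgn x = x" using assms by (simp add: sgn_div_norm)
  then show ?thesis
    using has_second_deriv_line[OF open_ball[of 0 1], of 0 "norm x" "sgn x" u Du D2u] assms Du D2u
    by (simp add: u_r_def u_rr_def)
qed

lemma f_le_at_sphere_max:
  assumes "norm x < 1" "x \<noteq> 0" "\<And>z. norm z = norm x \<Longrightarrow> u z \<le> u x"
  shows "f (u x) \<le> u_rr x + (real DIM('a) - 1) / norm x * u_r x"
  using laplacian_le_at_sphere_max[OF open_ball[of 0 1], of x u Du D2u] assms Du D2u
  by (simp add: u_r_def u_rr_def trace_D2u)

lemma f_ge_at_sphere_min:
  assumes "norm x < 1" "x \<noteq> 0" "\<And>z. norm z = norm x \<Longrightarrow> u x \<le> u z"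
  shows "u_rr x + (real DIM('a) - 1) / norm x * u_r x \<le> f (u x)"
  using laplacian_ge_at_sphere_min[OF open_ball[of 0 1], of x u Du D2u] assms Du D2u
  by (simp add: u_r_def u_rr_def trace_D2u)

text \<open>Maximum principle on balls of radius near 1. Where \<open>u > a\<close> the solution is
  subharmonic; the inner ball, where that may fail, carries only values below those of
  \<open>u\<close> near the unit sphere, so the maximum is not attained there.\<close>

lemma sphere_dominates:
  obtains r1 where "0 < r1" "r1 < 1"
    "\<And>x. r1 \<le> norm x \<Longrightarrow> norm x < 1 \<Longrightarrow> u x > a"
    "\<And>(x :: 'a) y. norm y \<le> norm x \<Longrightarrow> r1 \<le> norm x \<Longrightarrow> norm x < 1 \<Longrightarrow> \<exists>z. norm z = norm x \<and> u y \<le> u z"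
proof -
  obtain r0 where r0: "0 < r0" "r0 < 1" "\<And>x. r0 \<le> norm x \<Longrightarrow> norm x < 1 \<Longrightarrow> u x > a"
    using large_near_sphere[of a] by blast
  obtain C where C: "\<And>x. norm x \<le> r0 \<Longrightarrow> \<bar>u x\<bar> \<le> C"
    using bounded_on_cball[OF r0(2)] by blast
  obtain r1 where r1: "0 < r1" "r1 < 1" "\<And>x. r1 \<le> norm x \<Longrightarrow> norm x < 1 \<Longrightarrow> u x > C"
    using large_near_sphere[of C] by blast
  have ge: "r0 < norm x" if "r1 \<le> norm x" "norm x < 1" for x :: 'a
    using r1(3)[OF that] C[of x] by fastforce
  show ?thesis
  proof (rule that[of r1])
    fix x :: 'a assume x: "r1 \<le> norm x" "norm x < 1"
    show "u x > a" using r0(3)[of x] ge[OF x] x by simp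
  next
    fix x y :: 'a assume y: "norm y \<le> norm x" and x: "r1 \<le> norm x" "norm x < 1"
    define r where "r = norm x"
    have r: "r0 < r" "r < 1" using ge x by (auto simp: r_def)
    have "compact (sphere (0::'a) r)" "sphere (0::'a) r \<noteq> {}"
      using r r0 by (auto simp: r_def)
    then obtain z where z: "norm z = r" "\<And>z'. norm z' = r \<Longrightarrow> u z' \<le> u z"
      using continuous_attains_sup[of "sphere 0 r" u, OF _ _ continuous_on_u] r
      by (metis mem_sphere_0 subsetI mem_ball_0)
    have "u y \<le> u z + \<epsilon>" if \<epsilon>: "\<epsilon> > 0" for \<epsilon>
    proof -
      \<comment> \<open>The quadratic term makes the Laplacian of \<open>v\<close> strictly negative
        where \<open>u > a\<close>, so the minimum of \<open>v\<close> over the ball of radius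
        \<open>r\<close> lies on its sphere. At the end \<open>\<epsilon>\<close> is
        arbitrary.\<close>
      define v where "v = (\<lambda>x. - u x - \<epsilon> * (norm x)\<^sup>2)"
      have "continuous_on (cball 0 r) v"
        unfolding v_def using r by (intro continuous_intros continuous_on_u) auto
      then obtain m where m: "norm m \<le> r" "\<And>x. norm x \<le> r \<Longrightarrow> v m \<le> v x"
        using continuous_attains_inf[of "cball (0::'a) r" v] r r0 by auto
      have mr: "norm m = r"
      proof (rule ccontr)
        assume "norm m \<noteq> r"
        with m(1) have lt: "norm m < r" by simp
        have "\<not> norm m \<le> r0"
        proof
          assume m0: "norm m \<le> r0"
          then have "u m \<le> C" using C[of m] by simp
          moreover have "(norm m)\<^sup>2 \<le> r\<^sup>2" using lt by (intro power_mono) auto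
          then have "\<epsilon> * (norm m)\<^sup>2 \<le> \<epsilon> * (norm x)\<^sup>2" using \<epsilon> by (simp add: r_def)
          ultimately show False using m(2)[of x] r1(3)[OF x] by (simp add: v_def r_def)
        qed
        then have "u m > a" using r0(3)[of m] lt r by simp
        then have "f (u m) \<ge> 0" by (rule f_nonneg)
        moreover have "\<forall>\<^sub>F y in nhds m. v m \<le> v y"
          by (rule eventually_mono[OF eventually_nhds_in_open[of "ball 0 r"]]) (use lt m(2) in auto)
        moreover have "has_laplacian v m (- 1 * f (u m) - \<epsilon> * (2 * DIM('a)))"
          unfolding v_def
          using has_laplacian_diff[OF has_laplacian_cmult[OF has_laplacian_u, of m "-1"]
              has_laplacian_cmult[OF has_laplacian_norm_square, of \<epsilon> m]] lt r by simp
        ultimately have "- 1 * f (u m) - \<epsilon> * (2 * DIM('a)) \<ge> 0" using has_laplacian_local_min by blast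
        moreover have "\<epsilon> * (2 * DIM('a)) > 0" using \<epsilon> by simp
        ultimately show False using \<open>f (u m) \<ge> 0\<close> by linarith
      qed
      have "- u m - \<epsilon> * r\<^sup>2 \<le> - u y - \<epsilon> * (norm y)\<^sup>2"
        using m(2)[of y] y mr by (simp add: v_def r_def)
      moreover have "\<epsilon> * r\<^sup>2 \<le> \<epsilon>" using r r0 \<epsilon> by (simp add: power_le_one)
      moreover have "\<epsilon> * (norm y)\<^sup>2 \<ge> 0" using \<epsilon> by simp
      ultimately show ?thesis using z(2)[OF mr] by linarith
    qed
    then have "u y \<le> u z" by (rule field_le_epsilon)
    then show "\<exists>z. norm z = norm x \<and> u y \<le> u z" using z(1) r_def by blast
  qed (use r1 in auto)
qed

end

section \<open>Oscillation on spheres\<close>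

text \<open>
  The numbers \<open>q1, q2\<close> and \<open>p1, p2\<close> stand for the radial derivatives of \<open>u\<close> at a sphere minimum of
  radius \<open>r\<close> and a sphere maximum of radius \<open>\<rho>\<close>, \<open>\<phi>1, \<phi>2\<close> for those of the map between the radii, and
  \<open>h, h1, h2\<close> for a barrier; \<open>first\<close> and \<open>second\<close> are the conditions for a first contact.
\<close>

lemma tangency_contradiction:
  fixes fx fy ux uy p1 p2 q1 q2 \<phi>1 \<phi>2 h h1 h2 c r \<rho> m K :: real
  assumes x: "q2 + m / r * q1 \<le> fx" and y: "fy \<le> p2 + m / \<rho> * p1"
    and first: "q1 + c * h1 = p1 * \<phi>1" and second: "q2 + c * h2 \<ge> p2 * \<phi>1\<^sup>2 + p1 * \<phi>2"
    and p1: "p1 \<ge> 0" and fy: "fy \<ge> 0" and \<phi>1: "\<phi>1 \<ge> 1"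
    and \<phi>: "m * \<phi>1 * (\<phi>1 / \<rho> - 1 / r) \<le> \<phi>2"
    and h: "h2 + m / r * h1 + K * h < 0"
    and c: "c > 0" "uy - ux = c * h" and mono: "fx + K * ux \<le> fy + K * uy"
  shows False
proof -
  \<comment> \<open>The inequality for \<open>fy\<close> is scaled by \<open>\<phi>1\<^sup>2\<close>
    to match the second derivative of the composition. Eliminating \<open>p2\<close>,
    \<open>q2\<close> and \<open>q1\<close> through the contact conditions leaves
    \<open>fy \<le> fx + c * (h2 + m / r * h1)\<close>, hence
    \<open>fy + K * uy < fx + K * ux\<close>, against \<open>mono\<close>.\<close>
  have "\<phi>1\<^sup>2 * fy \<le> \<phi>1\<^sup>2 * (p2 + m / \<rho> * p1)" using y by (intro mult_left_mono) auto
  moreover have "1 * fy \<le> \<phi>1\<^sup>2 * fy" using fy \<phi>1 by (intro mult_right_mono) (auto simp: one_le_power)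
  moreover have "p1 * (m * \<phi>1 * (\<phi>1 / \<rho> - 1 / r)) \<le> p1 * \<phi>2" using p1 \<phi> by (rule mult_left_mono[rotated])
  moreover have "c * (h2 + m / r * h1 + K * h) < 0" using c h by (simp add: mult_pos_neg)
  moreover have "m / r * q1 = m / r * (p1 * \<phi>1 - c * h1)" using first by simp
  moreover have "K * (uy - ux) = c * (K * h)" by (simp add: c)
  ultimately show False using x second mono by (simp add: algebra_simps power2_eq_square)
qed

context large_ball_solution
begin

text \<open>
  The radius of the second point is shortened by a term of size \<open>\<eta>\<close>, so that the sphere maximum of
  \<open>u\<close> stays bounded up to the boundary; the concave profile of the shortening compensates for the
  curvature of the spheres.
\<close>

lemma sphere_oscillation_shortened:
  fixes r0 \<eta> c0 :: real
  defines "N \<equiv> real DIM('a)"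
  defines "\<phi> \<equiv> \<lambda>r. r - \<eta> * (1 - 8 * N * (r - r0)\<^sup>2)"
    and "h \<equiv> \<lambda>r. (1 - r) - (K + 1) * (1 - r)\<^sup>2"
  assumes r1: "1 / 2 \<le> r1"
      "\<And>x. r1 \<le> norm x \<Longrightarrow> norm x < 1 \<Longrightarrow> u x > a"
      "\<And>(x :: 'a) y. norm y \<le> norm x \<Longrightarrow> r1 \<le> norm x \<Longrightarrow> norm x < 1 \<Longrightarrow> \<exists>z. norm z = norm x \<and> u y \<le> u z"
    and r0: "3 / 4 \<le> r0" "r0 < 1" "1 - r0 \<le> 1 / (16 * N)" "1 - r0 \<le> 1 / (4 * (K + 1))"
    and \<eta>: "0 < \<eta>" "\<eta> < r0 - r1" 
    and c0: "c0 \<ge> 0" "\<And>x y. norm x = r0 \<Longrightarrow> norm y \<le> r0 \<Longrightarrow> u y - u x \<le> c0 * h r0"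
    and xy: "r0 \<le> norm x" "norm x < 1" "norm y = \<phi> (norm x)"
  shows "u y - u x \<le> c0 * h (norm x)"
proof (rule ccontr)
  assume viol: "\<not> u y - u x \<le> c0 * h (norm x)"
  have N: "N \<ge> 1" by (simp add: N_def Suc_leI)
  have \<eta>1: "\<eta> < 1 / 2" using \<eta> r0 r1 by simp
  have K1: "K + 1 > 0" using K_nonneg by simp
  then have K4: "(K + 1) * (1 / (4 * (K + 1))) = 1 / 4" by (simp add: field_simps)
  have hpos: "h r > 0" if r: "r0 \<le> r" "r < 1" for r
  proof -
    have "(K + 1) * (1 - r) \<le> (K + 1) * (1 / (4 * (K + 1)))"
      using r r0 K1 by (intro mult_left_mono) auto
    then have "(K + 1) * (1 - r) \<le> 1 / 4" unfolding K4 .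
    then have "(1 - r) * (1 - (K + 1) * (1 - r)) > 0" using r by (intro mult_pos_pos) auto
    then show ?thesis by (simp add: h_def power2_eq_square algebra_simps)
  qed
  have \<tau>: "0 \<le> 16 * N * (r - r0)" "16 * N * (r - r0) \<le> 1" "0 \<le> 8 * N * (r - r0)\<^sup>2" "8 * N * (r - r0)\<^sup>2 \<le> 1 / 2"
    if r: "r0 \<le> r" "r \<le> 1" for r
  proof -
    have 1: "16 * N * (r - r0) \<le> 16 * N * (1 / (16 * N))"
      using r r0 N by (intro mult_left_mono) auto
    then show 2: "16 * N * (r - r0) \<le> 1" using N by simp
    show 3: "0 \<le> 16 * N * (r - r0)" using N r by simp
    show "0 \<le> 8 * N * (r - r0)\<^sup>2" using N by simp
    have "(16 * N * (r - r0)) * (r - r0) \<le> 1 * 1"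
      using 2 3 r r0 by (intro mult_mono) auto
    then show "8 * N * (r - r0)\<^sup>2 \<le> 1 / 2" by (simp add: power2_eq_square algebra_simps)
  qed
  have \<phi>lt: "\<phi> r < r" "\<phi> r \<ge> r - \<eta>" if r: "r0 \<le> r" "r \<le> 1" for r
  proof -
    have "\<eta> * (1 - 8 * N * (r - r0)\<^sup>2) > 0" using \<tau>[OF r] \<eta> by (intro mult_pos_pos) auto
    then show "\<phi> r < r" by (simp add: \<phi>_def)
    have "\<eta> * (1 - 8 * N * (r - r0)\<^sup>2) \<le> \<eta> * 1" using \<tau>[OF r] \<eta> by (intro mult_left_mono) auto
    then show "\<phi> r \<ge> r - \<eta>" by (simp add: \<phi>_def)
  qed
  have \<phi>r1: "\<phi> r > r1" if "r0 \<le> r" "r \<le> 1" for r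
    using \<phi>lt[OF that] \<eta> that by simp
  have \<phi>le: "\<phi> r \<le> \<phi> 1" if r: "r0 \<le> r" "r \<le> 1" for r
  proof -
    have "(r - r0)\<^sup>2 \<le> (1 - r0)\<^sup>2" using r by (intro power_mono) auto
    then have "\<eta> * (1 - 8 * N * (1 - r0)\<^sup>2) \<le> \<eta> * (1 - 8 * N * (r - r0)\<^sup>2)"
      using \<eta> N by (intro mult_left_mono) (auto intro: mult_left_mono)
    then show ?thesis using r by (simp add: \<phi>_def)
  qed
  obtain C where C: "\<And>z. norm z \<le> \<phi> 1 \<Longrightarrow> \<bar>u z\<bar> \<le> C"
    using bounded_on_cball[OF \<phi>lt(1)[of 1]] r0 by auto
  \<comment> \<open>From radius \<open>r2\<close> on no violation is possible, because
    \<open>u\<close> exceeds there every value it takes in the closed ball of radius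
    \<open>\<phi> 1 < 1\<close>. This confines the search for the worst pair to a compact
    set.\<close>
  obtain r2 where r2: "r2 < 1" "\<And>z. r2 \<le> norm z \<Longrightarrow> norm z < 1 \<Longrightarrow> u z > C"
    using large_near_sphere[of C] by blast
  have xr2: "norm x < r2"
  proof (rule ccontr)
    assume "\<not> norm x < r2"
    then have "u x > C" using r2(2)[of x] xy by simp
    moreover have "u y \<le> C" using C[of y] \<phi>le[of "norm x"] xy by auto
    moreover have "c0 * h (norm x) \<ge> 0" using c0 hpos[of "norm x"] xy by simp
    ultimately show False using viol by simp
  qed
  define A where "A = (cball (0::'a) r2 - ball 0 r0) \<times> sphere (0::'a) 1"
  \<comment> \<open>The point \<open>x\<close> and the direction \<open>\<omega>\<close> vary
    independently. Hence at a maximizer with positive value the first point minimizes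
    \<open>u\<close> on its sphere and the second maximizes \<open>u\<close> on its own, and the
    maximal value \<open>c\<close> makes \<open>c * h\<close> touch the difference.\<close>
  define G where "G = (\<lambda>(x, \<omega>). (u (\<phi> (norm x) *\<^sub>R \<omega>) - u x) / h (norm x))"
  have Ax: "r0 \<le> norm (fst p)" "norm (fst p) \<le> r2" "norm (snd p) = 1" if "p \<in> A" for p
    using that by (auto simp: A_def)
  have y0: "y \<noteq> 0" using xy \<phi>r1[of "norm x"] r1 by auto
  have yx: "y = \<phi> (norm x) *\<^sub>R sgn y" unfolding xy(3)[symmetric] using y0 by (simp add: sgn_div_norm)
  have xA: "(x, sgn y) \<in> A" using xy xr2 y0 by (auto simp: A_def norm_sgn)
  have "continuous_on A G"
    unfolding G_def case_prod_beta
  proof (intro continuous_intros continuous_on_compose2[OF continuous_on_u[OF order_refl]])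
    show "continuous_on A (\<lambda>p. \<phi> (norm (fst p)))" "continuous_on A (\<lambda>p. h (norm (fst p)))"
      unfolding \<phi>_def h_def by (intro continuous_intros)+
    show "(\<lambda>p. \<phi> (norm (fst p)) *\<^sub>R snd p) ` A \<subseteq> ball 0 1"
    proof safe
      fix p assume "p \<in> A"
      then show "\<phi> (norm (fst p)) *\<^sub>R snd p \<in> ball 0 1"
        using Ax[of p] \<phi>lt[of "norm (fst p)"] r2 \<phi>r1[of "norm (fst p)"] r1(1) by simp
    qed
    have lt: "norm (fst p) < 1" if "p \<in> A" for p using Ax(2)[OF that] r2(1) by simp
    then show "fst ` A \<subseteq> ball 0 1" by auto
    show "\<forall>p\<in>A. h (norm (fst p)) \<noteq> 0"
    proof
      fix p assume "p \<in> A"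
      then show "h (norm (fst p)) \<noteq> 0" using hpos[OF Ax(1) lt] by (metis less_irrefl)
    qed
  qed
  moreover have "compact A" unfolding A_def by (intro compact_Times compact_diff) auto
  ultimately obtain p where p: "p \<in> A" "\<And>p'. p' \<in> A \<Longrightarrow> G p' \<le> G p"
    using continuous_attains_sup[of A G] xA by blast
  obtain X \<omega> where pX: "p = (X, \<omega>)" by fastforce
  define Y where "Y = \<phi> (norm X) *\<^sub>R \<omega>"
  define c where "c = G p"
  have X: "r0 \<le> norm X" "norm X \<le> r2" "norm X < 1" "norm \<omega> = 1"
    using Ax[OF p(1)] r2(1) by (auto simp: pX)
  have c: "u Y - u X = c * h (norm X)"
    using hpos[OF X(1) X(3)] by (simp add: c_def pX G_def Y_def)
  have cmax: "u (\<phi> (norm x') *\<^sub>R \<omega>') - u x' \<le> c * h (norm x')"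
    if "r0 \<le> norm x'" "norm x' \<le> r2" "norm \<omega>' = 1" for x' \<omega>'
  proof -
    have "(x', \<omega>') \<in> A" using that by (auto simp: A_def)
    then have "G (x', \<omega>') \<le> c" using p(2) c_def by simp
    then show ?thesis using hpos[of "norm x'"] that r2(1) by (simp add: G_def field_simps)
  qed
  \<comment> \<open>On the sphere of radius \<open>r0\<close> the constant \<open>c0\<close>
    suffices, so \<open>c > c0\<close> keeps the maximizer off it.\<close>
  have cc0: "c > c0"
  proof -
    have "u y - u x \<le> c * h (norm x)"
      using cmax[of x "sgn y"] xy xr2 y0 yx by (auto simp: norm_sgn)
    then have "c0 * h (norm x) < c * h (norm x)" using viol by linarith
    then show ?thesis using hpos[of "norm x"] xy by simp
  qed
  then have cpos: "c > 0" using c0 by simp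
  have nY: "norm Y = \<phi> (norm X)" using X \<phi>r1[of "norm X"] r1(1) by (simp add: Y_def)
  have Y: "r1 < norm Y" "norm Y < norm X" using \<phi>r1[of "norm X"] \<phi>lt[of "norm X"] X nY by auto
  have Xr0: "norm X \<noteq> r0"
  proof
    assume "norm X = r0"
    then have "c * h r0 \<le> c0 * h r0" using c0(2)[of X Y] Y c by simp
    then show False using cc0 hpos[of r0] r0 by simp
  qed
  have Xr2: "norm X \<noteq> r2"
  proof
    assume "norm X = r2"
    then have "u X > C" using r2 X by simp
    moreover have "u Y \<le> C" using C[of Y] \<phi>le[of "norm X"] X nY by auto
    moreover have "c * h (norm X) > 0" using cpos hpos X by simp
    ultimately show False using c by simp
  qed
  have Xi: "r0 < norm X" "norm X < r2" using X Xr0 Xr2 by auto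
  have X0: "X \<noteq> 0" and Y0: "Y \<noteq> 0" using Xi r0 Y r1 by auto
  have sgnY: "sgn Y = \<omega>" 
    using X \<phi>r1[of "norm X"] r1(1) by (simp add: Y_def sgn_scaleR) (simp add: sgn_div_norm)
  have Ymax: "u z \<le> u Y" if z: "norm z = norm Y" for z
  proof -
    have "norm z *\<^sub>R sgn z = z" by (cases "z = 0") (simp_all add: sgn_div_norm)
    then have "\<phi> (norm X) *\<^sub>R sgn z = z" using z nY by simp
    moreover have "norm (sgn z) = 1" using z Y0 by (auto simp: norm_sgn)
    ultimately show ?thesis using cmax[of X "sgn z"] X c by auto
  qed
  have Xmin: "u X \<le> u z" if z: "norm z = norm X" for z
    using cmax[of z \<omega>] X c z Y_def by auto
  define \<phi>1 where "\<phi>1 = 1 + 16 * N * \<eta> * (norm X - r0)"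
  \<comment> \<open>The factor 8 in \<open>\<phi>\<close> is chosen so that this second derivative
    dominates the curvature term: \<open>m * \<phi>1 \<le> 2 * N\<close>, and
    \<open>\<phi>1 / norm Y - 1 / norm X\<close> is at most \<open>8 * \<eta>\<close>.\<close>
  define \<phi>2 where "\<phi>2 = 16 * N * \<eta>"
  define h1 where "h1 = - 1 + 2 * (K + 1) * (1 - norm X)"
  define h2 where "h2 = - 2 * (K + 1)"
  have d\<phi>: "has_second_deriv \<phi> (norm X) \<phi>1 \<phi>2"
    unfolding \<phi>_def
    by (rule has_second_derivI[where S = UNIV and g' = "\<lambda>r. 1 + 16 * N * \<eta> * (r - r0)"])
       (auto intro!: derivative_eq_intros simp: \<phi>1_def \<phi>2_def algebra_simps)
  have dh: "has_second_deriv h (norm X) h1 h2"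
    unfolding h_def
    by (rule has_second_derivI[where S = UNIV and g' = "\<lambda>r. - 1 + 2 * (K + 1) * (1 - r)"])
       (auto intro!: derivative_eq_intros simp: h1_def h2_def algebra_simps)
  have dY: "has_second_deriv (\<lambda>r. u (r *\<^sub>R \<omega>)) (\<phi> (norm X)) (u_r Y) (u_rr Y)"
    using has_second_deriv_radial[of Y] Y0 Y X unfolding sgnY nY by simp
  \<comment> \<open>Both directions are frozen and only the radius moves. Near \<open>norm X\<close>
    this function is nonnegative and it vanishes at \<open>norm X\<close>, so its derivatives there
    give the two contact conditions.\<close>
  have d: "has_second_deriv (\<lambda>r. u (r *\<^sub>R sgn X) + c * h r - u (\<phi> r *\<^sub>R \<omega>)) (norm X)
      (u_r X + c * h1 - u_r Y * \<phi>1) (u_rr X + c * h2 - (u_rr Y * \<phi>1\<^sup>2 + u_r Y * \<phi>2))"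
    by (intro has_second_deriv_add has_second_deriv_diff has_second_deriv_cmult dh
        has_second_deriv_compose[OF dY d\<phi>] has_second_deriv_radial X X0)
  have min: "\<forall>\<^sub>F r in nhds (norm X). u (norm X *\<^sub>R sgn X) + c * h (norm X) - u (\<phi> (norm X) *\<^sub>R \<omega>)
      \<le> u (r *\<^sub>R sgn X) + c * h r - u (\<phi> r *\<^sub>R \<omega>)"
  proof (rule eventually_mono[OF eventually_nhds_in_open[of "{r0<..<r2}"]])
    show "norm X \<in> {r0<..<r2}" using Xi by simp
    fix r assume r: "r \<in> {r0<..<r2}"
    then have "norm (r *\<^sub>R sgn X) = r" using r0 X0 by (simp add: norm_sgn)
    then have "u (\<phi> r *\<^sub>R \<omega>) - u (r *\<^sub>R sgn X) \<le> c * h r"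
      using cmax[of "r *\<^sub>R sgn X" \<omega>] X r by simp
    moreover have "norm X *\<^sub>R sgn X = X" using X0 by (simp add: sgn_div_norm)
    ultimately show "u (norm X *\<^sub>R sgn X) + c * h (norm X) - u (\<phi> (norm X) *\<^sub>R \<omega>)
      \<le> u (r *\<^sub>R sgn X) + c * h r - u (\<phi> r *\<^sub>R \<omega>)"
      using c by (simp add: Y_def[symmetric])
  qed simp
  \<comment> \<open>A negative radial derivative would give a point of smaller norm with a value
    above the maximum over the sphere through \<open>Y\<close>, against
    \<open>r1(3)\<close>.\<close>
  have u_r_Y: "u_r Y \<ge> 0"
  proof (rule ccontr)
    assume "\<not> u_r Y \<ge> 0"
    then obtain e where e: "e > 0" "\<And>s. 0 < s \<Longrightarrow> s < e \<Longrightarrow> u (norm Y *\<^sub>R \<omega>) < u ((norm Y - s) *\<^sub>R \<omega>)"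
      using has_real_derivative_neg_dec_left[OF has_second_deriv_imp_deriv[OF dY]] nY by auto
    obtain s where s: "0 < s" "s < e" "s < norm Y"
      using field_lbound_gt_zero[OF e(1), of "norm Y"] Y0 by auto
    have "\<exists>z. norm z = norm Y \<and> u ((norm Y - s) *\<^sub>R \<omega>) \<le> u z"
      by (rule r1(3)) (use s X Y in auto)
    then have "u ((norm Y - s) *\<^sub>R \<omega>) \<le> u Y" using Ymax order_trans by blast
    moreover have "norm Y *\<^sub>R \<omega> = Y" unfolding nY by (simp add: Y_def)
    ultimately show False using e(2)[OF s(1,2)] by simp
  qed
  define m where "m = N - 1"
  have m: "m \<ge> 0" using N by (simp add: m_def)
  show False
  proof (rule tangency_contradiction)
    show "u_rr X + m / norm X * u_r X \<le> f (u X)"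
      using f_ge_at_sphere_min[OF X(3) X0 Xmin] by (simp add: m_def N_def)
    show "f (u Y) \<le> u_rr Y + m / norm Y * u_r Y"
      using f_le_at_sphere_max[of Y] Ymax Y X Y0 by (simp add: m_def N_def)
    show "u_r X + c * h1 = u_r Y * \<phi>1" "u_rr Y * \<phi>1\<^sup>2 + u_r Y * \<phi>2 \<le> u_rr X + c * h2"
      using has_second_deriv_local_min[OF d min] by auto
    show "u_r Y \<ge> 0" by (rule u_r_Y)
    show "f (u Y) \<ge> 0" using Y X by (intro f_nonneg r1(2)) auto
    have e16: "0 \<le> 16 * N * (norm X - r0)" "16 * N * (norm X - r0) \<le> 1"
      using \<tau>[of "norm X"] X by auto
    then have sl: "0 \<le> 16 * N * \<eta> * (norm X - r0)" "16 * N * \<eta> * (norm X - r0) \<le> \<eta>"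
      using \<eta> mult_left_mono[of "16 * N * (norm X - r0)" 1 \<eta>]
        mult_nonneg_nonneg[of \<eta> "16 * N * (norm X - r0)"] by (auto simp: algebra_simps)
    then show \<phi>11: "\<phi>1 \<ge> 1" by (simp add: \<phi>1_def)
    have \<phi>12: "\<phi>1 \<le> 2" using sl \<eta>1 by (simp add: \<phi>1_def)
    have "norm X * \<phi>1 - norm Y = norm X * (16 * N * \<eta> * (norm X - r0)) + (norm X - norm Y)"
      by (simp add: \<phi>1_def algebra_simps)
    also have "\<dots> \<le> 1 * \<eta> + \<eta>"
      using sl X \<phi>lt[of "norm X"] nY \<eta> by (intro add_mono mult_mono) auto
    finally have num: "norm X * \<phi>1 - norm Y \<le> 2 * \<eta>" by simp
    have "1 / 2 * (1 / 2) \<le> norm Y * norm X" using Y X r1 r0 by (intro mult_mono) auto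
    then have den: "1 / 4 \<le> norm Y * norm X" by simp
    have "\<phi>1 / norm Y - 1 / norm X = (norm X * \<phi>1 - norm Y) / (norm Y * norm X)"
      using X0 Y0 by (simp add: field_simps)
    also have "\<dots> \<le> 2 * \<eta> / (1 / 4)"
      using num den \<eta> Y X by (intro frac_le) auto
    finally have "\<phi>1 / norm Y - 1 / norm X \<le> 8 * \<eta>" by simp
    then have "m * \<phi>1 * (\<phi>1 / norm Y - 1 / norm X) \<le> m * \<phi>1 * (8 * \<eta>)"
      using m \<phi>11 by (intro mult_left_mono) auto
    also have "\<dots> \<le> N * 2 * (8 * \<eta>)"
      using m \<phi>11 \<phi>12 \<eta> m_def by (intro mult_mono) auto
    finally show "m * \<phi>1 * (\<phi>1 / norm Y - 1 / norm X) \<le> \<phi>2" by (simp add: \<phi>2_def)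
    \<comment> \<open>The coefficient \<open>K + 1\<close> in \<open>h\<close> is made for this:
      \<open>h2 = - 2 * (K + 1)\<close> outweighs \<open>K * h \<le> K\<close>, while the smallness
      of \<open>1 - r0\<close> keeps \<open>h1 \<le> 0\<close>.\<close>
    have "(K + 1) * (1 - norm X) \<le> (K + 1) * (1 / (4 * (K + 1)))"
      using Xi r0 K1 by (intro mult_left_mono) auto
    then have "h1 \<le> 0" unfolding K4 h1_def by (simp add: algebra_simps)
    then have "m / norm X * h1 \<le> 0" using m X0 by (simp add: mult_nonneg_nonpos divide_nonpos_nonneg)
    moreover have "h (norm X) \<le> 1"
    proof -
      have "(K + 1) * (1 - norm X)\<^sup>2 \<ge> 0" using K1 by simp
      then show ?thesis using norm_ge_zero[of X] unfolding h_def by linarith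
    qed
    then have "K * h (norm X) \<le> K" using K_nonneg mult_left_mono by fastforce
    ultimately show "h2 + m / norm X * h1 + K * h (norm X) < 0"
      using K_nonneg by (simp add: h2_def)
    show "c > 0" by (rule cpos)
    show "u Y - u X = c * h (norm X)" by (rule c)
    have "u X \<le> u Y" using c mult_pos_pos[OF cpos hpos[OF X(1) X(3)]] by linarith
    then show "f (u X) + K * u X \<le> f (u Y) + K * u Y" by (rule f_quasimono)
  qed
qed


text \<open>The constant in the shortened estimate does not depend on \<open>\<eta>\<close>, so
  \<open>\<eta>\<close> can tend to 0 at fixed points by continuity of \<open>u\<close>; the bound
  then follows from \<open>h r \<le> 1 - r\<close>.\<close>

lemma sphere_oscillation:
  obtains r0 c where "0 < r0" "r0 < 1" "c \<ge> 0"
    "\<And>(x :: 'a) y. norm y = norm x \<Longrightarrow> r0 \<le> norm x \<Longrightarrow> norm x < 1 \<Longrightarrow> u y - u x \<le> c * (1 - norm x)"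
proof -
  obtain r1' where r1': "0 < r1'" "r1' < 1"
    "\<And>x. r1' \<le> norm x \<Longrightarrow> norm x < 1 \<Longrightarrow> u x > a"
    "\<And>(x :: 'a) y. norm y \<le> norm x \<Longrightarrow> r1' \<le> norm x \<Longrightarrow> norm x < 1 \<Longrightarrow> \<exists>z. norm z = norm x \<and> u y \<le> u z"
    using sphere_dominates by blast
  define r1 where "r1 = max (1 / 2) r1'"
  have r1: "1 / 2 \<le> r1" "r1' \<le> r1" "r1 < 1" using r1' by (auto simp: r1_def)
  define N where "N = real DIM('a)"
  have N: "N \<ge> 1" by (simp add: N_def Suc_leI)
  have K1: "K + 1 > 0" using K_nonneg by simp
  obtain \<delta>1 where \<delta>1: "0 < \<delta>1" "\<delta>1 < 1 / 4" "\<delta>1 < (1 - r1) / 2"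
    using field_lbound_gt_zero[of "1 / 4" "(1 - r1) / 2"] r1 by auto
  obtain \<delta>2 where \<delta>2: "0 < \<delta>2" "\<delta>2 < 1 / (16 * N)" "\<delta>2 < 1 / (4 * (K + 1))"
    using field_lbound_gt_zero[of "1 / (16 * N)" "1 / (4 * (K + 1))"] N K1 by auto
  obtain \<delta> where "0 < \<delta>" "\<delta> < \<delta>1" "\<delta> < \<delta>2"
    using field_lbound_gt_zero[of \<delta>1 \<delta>2] \<delta>1 \<delta>2 by auto
  with \<delta>1 \<delta>2 have \<delta>: "0 < \<delta>" "\<delta> \<le> 1 / 4" "\<delta> \<le> (1 - r1) / 2" "\<delta> \<le> 1 / (16 * N)" "\<delta> \<le> 1 / (4 * (K + 1))"
    by linarith+
  define r0 where "r0 = 1 - \<delta>"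
  have r0: "3 / 4 \<le> r0" "r0 < 1" "1 - r0 \<le> 1 / (16 * N)" "1 - r0 \<le> 1 / (4 * (K + 1))" "r1 < r0"
    using \<delta> r1 by (auto simp: r0_def field_simps)
  define h where "h = (\<lambda>r. (1 - r) - (K + 1) * (1 - r)\<^sup>2)"
  have h0: "h r0 > 0"
  proof -
    have "(K + 1) * \<delta> \<le> (K + 1) * (1 / (4 * (K + 1)))" using \<delta> K1 by (intro mult_left_mono) auto
    also have "\<dots> = 1 / 4" using K1 by (simp add: field_simps)
    finally have "\<delta> * (1 - (K + 1) * \<delta>) > 0" using \<delta> by (intro mult_pos_pos) auto
    then show ?thesis by (simp add: h_def r0_def power2_eq_square algebra_simps)
  qed
  obtain C where C: "C \<ge> 0" "\<And>x. norm x \<le> r0 \<Longrightarrow> \<bar>u x\<bar> \<le> C"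
    using bounded_on_cball[OF r0(2)] by blast
  \<comment> \<open>With this choice \<open>c * h r0 = 2 * C\<close> bounds the oscillation of
    \<open>u\<close> over the closed ball of radius \<open>r0\<close>, so the condition on the inner
    sphere holds for every \<open>\<eta>\<close>.\<close>
  define c where "c = 2 * C / h r0"
  have c: "c \<ge> 0" using C h0 by (simp add: c_def)
  have c0: "u y - u x \<le> c * h r0" if "norm x = r0" "norm y \<le> r0" for x y
  proof -
    have "c * h r0 = 2 * C" using h0 by (simp add: c_def)
    then show ?thesis using C(2)[of x] C(2)[of y] that by auto
  qed
  show ?thesis
  proof (rule that[of r0 c])
    fix x y :: 'a assume xy: "norm y = norm x" "r0 \<le> norm x" "norm x < 1"
    define r where "r = norm x"
    define \<phi> where "\<phi> = (\<lambda>\<eta>. r - \<eta> * (1 - 8 * N * (r - r0)\<^sup>2))"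
    have "y \<noteq> 0" using xy r0 by auto
    then have y: "r *\<^sub>R sgn y = y" "norm (sgn y) = 1"
      unfolding r_def xy(1)[symmetric] by (simp_all add: sgn_div_norm)
    have "u (\<phi> \<eta> *\<^sub>R sgn y) \<le> u x + c * h r" if \<eta>: "0 < \<eta>" "\<eta> < r0 - r1" for \<eta>
    proof -
      have pos: "\<phi> \<eta> \<ge> 0"
      proof -
        have "\<eta> * (1 - 8 * N * (r - r0)\<^sup>2) \<le> \<eta> * 1" using \<eta> N by (intro mult_left_mono) auto
        then show ?thesis unfolding \<phi>_def using \<eta> r1 xy r_def by linarith
      qed
      have "u (\<phi> \<eta> *\<^sub>R sgn y) - u x \<le> c * ((1 - norm x) - (K + 1) * (1 - norm x)\<^sup>2)"
      proof (rule sphere_oscillation_shortened[where ?r1.0 = r1 and ?r0.0 = r0 and \<eta> = \<eta>])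
        show "norm (\<phi> \<eta> *\<^sub>R sgn y) = norm x - \<eta> * (1 - 8 * real DIM('a) * (norm x - r0)\<^sup>2)"
          using pos y(2) by (simp add: \<phi>_def r_def N_def)
      qed (use r1 r1' r0 \<eta> c c0 xy in \<open>auto simp: N_def h_def\<close>)
      then show ?thesis by (simp add: h_def r_def)
    qed
    then have ev: "\<forall>\<^sub>F \<eta> in at_right 0. u (\<phi> \<eta> *\<^sub>R sgn y) \<le> u x + c * h r"
      unfolding eventually_at_right_field using r0 by (intro exI[of _ "r0 - r1"]) auto
    have "isCont u (\<phi> 0 *\<^sub>R sgn y)" using y xy by (intro isCont_u) (simp add: \<phi>_def)
    then have "((\<lambda>\<eta>. u (\<phi> \<eta> *\<^sub>R sgn y)) \<longlongrightarrow> u (\<phi> 0 *\<^sub>R sgn y)) (at_right 0)"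
      by (rule isCont_tendsto_compose) (auto simp: \<phi>_def intro!: tendsto_eq_intros)
    from tendsto_upperbound[OF this ev] have "u y \<le> u x + c * h r"
      using y by (simp add: \<phi>_def)
    moreover have "h r \<le> 1 - r" using K1 by (simp add: h_def)
    then have "c * h r \<le> c * (1 - r)" using c by (rule mult_left_mono)
    ultimately show "u y - u x \<le> c * (1 - norm x)" by (simp add: r_def)
  qed (use r0 c in auto)
qed

text \<open>\<open>sphere_dominates\<close> bounds \<open>u y\<close> by a value on the sphere
  through \<open>x\<close>, and the oscillation on that sphere is at most
  \<open>c * (1 - norm x)\<close>.\<close>

lemma boundary_comparison:
  assumes "\<epsilon> > 0"
  obtains r where "0 < r" "r < 1"
    "\<And>(x :: 'a) y. norm y \<le> norm x \<Longrightarrow> r \<le> norm x \<Longrightarrow> norm x < 1 \<Longrightarrow> u y \<le> u x + \<epsilon>"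
proof -
  obtain r1 where r1: "0 < r1" "r1 < 1" "\<And>x. r1 \<le> norm x \<Longrightarrow> norm x < 1 \<Longrightarrow> u x > a"
    "\<And>(x :: 'a) y. norm y \<le> norm x \<Longrightarrow> r1 \<le> norm x \<Longrightarrow> norm x < 1 \<Longrightarrow> \<exists>z. norm z = norm x \<and> u y \<le> u z"
    using sphere_dominates by blast
  obtain r0 c where r0: "0 < r0" "r0 < 1" "c \<ge> 0"
    "\<And>(x :: 'a) y. norm y = norm x \<Longrightarrow> r0 \<le> norm x \<Longrightarrow> norm x < 1 \<Longrightarrow> u y - u x \<le> c * (1 - norm x)"
    using sphere_oscillation by blast
  \<comment> \<open>The denominator \<open>c + 1\<close> is positive even when
    \<open>c = 0\<close>.\<close>
  define r where "r = max (max r0 r1) (1 - \<epsilon> / (c + 1))"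
  have "\<epsilon> / (c + 1) > 0" using assms r0 by simp
  then have r: "r0 \<le> r" "r1 \<le> r" "1 - \<epsilon> / (c + 1) \<le> r" "r < 1"
    unfolding r_def using r0 r1 by linarith+
  show ?thesis
  proof (rule that[of r])
    fix x y :: 'a assume xy: "norm y \<le> norm x" "r \<le> norm x" "norm x < 1"
    obtain z where z: "norm z = norm x" "u y \<le> u z" using r1(4)[of y x] xy r by auto
    have "u z - u x \<le> c * (1 - norm x)" using r0(4)[of z x] z xy r by simp
    also have "\<dots> \<le> (c + 1) * (\<epsilon> / (c + 1))"
      using r0(3) xy r by (intro mult_mono) auto
    also have "\<dots> = \<epsilon>" using r0(3) by simp
    finally show "u y \<le> u x + \<epsilon>" using z by simp
  qed (use r r0 in auto)
qed

end

section \<open>Moving planes\<close>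

lemma closedin_sequentialI:
  fixes S T :: "'a::metric_space set"
  assumes "T \<subseteq> S" "\<And>X z. (\<And>n. X n \<in> T) \<Longrightarrow> z \<in> S \<Longrightarrow> X \<longlonglongrightarrow> z \<Longrightarrow> z \<in> T"
  shows "closedin (top_of_set S) T"
  unfolding closedin_limpt islimpt_sequential using assms by blast

definition hyperplane_reflection :: "'a::euclidean_space \<Rightarrow> real \<Rightarrow> 'a \<Rightarrow> 'a" where
  "hyperplane_reflection e l x = x + (2 * (l - x \<bullet> e)) *\<^sub>R e"

lemma norm_hyperplane_reflection:
  assumes "norm e = 1"
  shows "(norm (hyperplane_reflection e l x))\<^sup>2 = (norm x)\<^sup>2 - 4 * l * (x \<bullet> e - l)"
proof -
  have "e \<bullet> e = 1" using assms by (simp add: dot_square_norm)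
  then show ?thesis
    unfolding power2_norm_eq_inner hyperplane_reflection_def
    by (simp add: inner_simps inner_commute algebra_simps power2_eq_square)
qed

text \<open>This keeps the reflected cap inside the ball and makes
  \<open>boundary_comparison\<close> applicable to a point and its mirror image.\<close>

lemma norm_hyperplane_reflection_le:
  assumes "norm e = 1" "0 \<le> l" "l \<le> x \<bullet> e"
  shows "norm (hyperplane_reflection e l x) \<le> norm x"
proof (rule power2_le_imp_le)
  have "4 * l * (x \<bullet> e - l) \<ge> 0" using assms by (intro mult_nonneg_nonneg) auto
  then show "(norm (hyperplane_reflection e l x))\<^sup>2 \<le> (norm x)\<^sup>2"
    using norm_hyperplane_reflection[OF assms(1), of l x] by linarith
qed simp

lemma norm_hyperplane_reflection_less:
  assumes "norm e = 1" "0 < l" "l < x \<bullet> e"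
  shows "norm (hyperplane_reflection e l x) < norm x"
proof (rule power2_less_imp_less)
  have "4 * l * (x \<bullet> e - l) > 0" using assms by (intro mult_pos_pos) auto
  then show "(norm (hyperplane_reflection e l x))\<^sup>2 < (norm x)\<^sup>2"
    using norm_hyperplane_reflection[OF assms(1), of l x] by linarith
qed simp

lemma tendsto_hyperplane_reflection [tendsto_intros]:
  "(l \<longlongrightarrow> l') F \<Longrightarrow> (x \<longlongrightarrow> x') F \<Longrightarrow>
    ((\<lambda>n. hyperplane_reflection e (l n) (x n)) \<longlongrightarrow> hyperplane_reflection e l' x') F"
  unfolding hyperplane_reflection_def by (intro tendsto_intros)

lemma continuous_on_hyperplane_reflection [continuous_intros]:
  "continuous_on S (hyperplane_reflection e l)"
  unfolding hyperplane_reflection_def by (intro continuous_intros)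

text \<open>The vectors inserted are the images of the standard basis under the linear part of the
  reflection, again an orthonormal basis. This is the invariance of the Laplacian under
  reflections.\<close>

lemma trace_reflection:
  fixes T :: "'a::euclidean_space \<Rightarrow>\<^sub>L 'a \<Rightarrow>\<^sub>L real" and e :: 'a
  assumes "norm e = 1"
  shows "(\<Sum>b\<in>Basis. T (b - (2 * (b \<bullet> e)) *\<^sub>R e) (b - (2 * (b \<bullet> e)) *\<^sub>R e)) = (\<Sum>b\<in>Basis. T b b)"
proof -
  have "e \<bullet> e = 1" using assms by (simp add: dot_square_norm)
  then have sq: "(\<Sum>b\<in>Basis. (b \<bullet> e) * (b \<bullet> e)) = 1"
    unfolding euclidean_inner[of e e] by (simp add: inner_commute)
  have rep: "(\<Sum>b\<in>Basis. (b \<bullet> e) *\<^sub>R b) = e"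
    using euclidean_representation[of e] by (simp add: inner_commute)
  have "(\<Sum>b\<in>Basis. T (b - (2 * (b \<bullet> e)) *\<^sub>R e) (b - (2 * (b \<bullet> e)) *\<^sub>R e)) =
      (\<Sum>b\<in>Basis. T b b - 2 * T ((b \<bullet> e) *\<^sub>R b) e - 2 * T e ((b \<bullet> e) *\<^sub>R b)
        + 4 * ((b \<bullet> e) * (b \<bullet> e)) * T e e)"
    by (rule sum.cong)
       (auto simp: blinfun.diff_left blinfun.diff_right blinfun.scaleR_left
          blinfun.scaleR_right algebra_simps)
  also have "\<dots> = (\<Sum>b\<in>Basis. T b b) - 2 * T (\<Sum>b\<in>Basis. (b \<bullet> e) *\<^sub>R b) e
      - 2 * T e (\<Sum>b\<in>Basis. (b \<bullet> e) *\<^sub>R b) + 4 * (\<Sum>b\<in>Basis. (b \<bullet> e) * (b \<bullet> e)) * T e e"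
    by (simp add: sum.distrib sum_subtractf blinfun.sum_left blinfun.sum_right
        sum_distrib_right sum_distrib_left)
  finally show ?thesis by (simp add: sq rep)
qed

context large_ball_solution
begin

definition refl_diff :: "'a \<Rightarrow> real \<Rightarrow> 'a \<Rightarrow> real" where
  "refl_diff e l x = u x - u (hyperplane_reflection e l x)"

definition refl_ordered :: "'a \<Rightarrow> real \<Rightarrow> bool" where
  "refl_ordered e l \<longleftrightarrow> (\<forall>x. norm x < 1 \<longrightarrow> l < x \<bullet> e \<longrightarrow> 0 \<le> refl_diff e l x)"

lemma has_laplacian_refl_diff:
  assumes e: "norm e = 1" and x: "norm x < 1" "norm (hyperplane_reflection e l x) < 1"
  shows "has_laplacian (refl_diff e l) x (f (u x) - f (u (hyperplane_reflection e l x)))"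
proof -
  let ?y = "hyperplane_reflection e l x"
  have "has_laplacian (\<lambda>x. u (hyperplane_reflection e l x)) x (f (u ?y))"
  proof (rule has_laplacianI)
    fix b :: 'a
    have "hyperplane_reflection e l (x + t *\<^sub>R b) = ?y + t *\<^sub>R (b - (2 * (b \<bullet> e)) *\<^sub>R e)" for t
      by (simp add: hyperplane_reflection_def inner_simps algebra_simps)
    then show "has_second_deriv (\<lambda>t. u (hyperplane_reflection e l (x + t *\<^sub>R b))) 0
        (Du ?y (b - (2 * (b \<bullet> e)) *\<^sub>R e))
        (D2u ?y (b - (2 * (b \<bullet> e)) *\<^sub>R e) (b - (2 * (b \<bullet> e)) *\<^sub>R e))"
      using has_second_deriv_line[OF open_ball[of 0 1], of ?y 0 "b - (2 * (b \<bullet> e)) *\<^sub>R e" u Du D2u] x Du D2u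
      by simp
  qed (use trace_reflection[OF e] trace_D2u[OF x(2)] in simp)
  from has_laplacian_diff[OF has_laplacian_u[OF x(1)] this]
  show ?thesis by (simp add: refl_diff_def[abs_def])
qed

lemma tendsto_refl_diff:
  assumes "(l \<longlongrightarrow> l') F" "(x \<longlongrightarrow> x') F" "norm x' < 1" "norm (hyperplane_reflection e l' x') < 1"
  shows "((\<lambda>n. refl_diff e (l n) (x n)) \<longlongrightarrow> refl_diff e l' x') F"
  unfolding refl_diff_def using assms
  by (intro tendsto_intros isCont_tendsto_compose[OF isCont_u])

lemma continuous_on_refl_diff:
  assumes "norm e = 1" "0 \<le> l" "\<And>x. x \<in> S \<Longrightarrow> norm x < 1 \<and> l \<le> x \<bullet> e"
  shows "continuous_on S (refl_diff e l)"
proof -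
  have "norm (hyperplane_reflection e l x) < 1" if "x \<in> S" for x
    using norm_hyperplane_reflection_le[OF assms(1,2), of x] assms(3)[OF that] by simp
  then have "continuous_on S (\<lambda>x. u (hyperplane_reflection e l x))"
    by (intro continuous_on_compose2[OF continuous_on_u[OF order_refl]]
        continuous_on_hyperplane_reflection) auto
  moreover have "continuous_on S u" using assms(3) by (intro continuous_on_u) auto
  ultimately show ?thesis
    unfolding refl_diff_def[abs_def] by (rule continuous_on_diff[rotated])
qed

text \<open>Maximum principle for \<open>w / h\<close> with a concave \<open>h\<close> whose
  Laplacian \<open>- 2 * (K + 1)\<close> outweighs the zero-order term of size \<open>K\<close>. A
  negative minimum is kept off the plane by \<open>w = 0\<close> there, off the far side by
  \<open>far\<close>, and off the unit sphere by \<open>boundary_comparison\<close>.\<close>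

lemma narrow_strip_nonneg:
  assumes e: "norm e = 1" and l: "0 \<le> l" and \<delta>: "0 < \<delta>" "2 * (K + 1) * \<delta>\<^sup>2 \<le> 1"
    and far: "\<And>x. norm x < 1 \<Longrightarrow> x \<bullet> e = l + \<delta> \<Longrightarrow> 0 \<le> refl_diff e l x"
    and x: "norm x < 1" "l < x \<bullet> e" "x \<bullet> e < l + \<delta>"
  shows "0 \<le> refl_diff e l x"
proof (rule ccontr)
  assume "\<not> 0 \<le> refl_diff e l x"
  then have neg: "refl_diff e l x < 0" by simp
  define w where "w = refl_diff e l"
  \<comment> \<open>A third of the depth suffices: with \<open>h \<ge> 1/2\<close> the minimizer
    satisfies \<open>w z \<le> - 3/2 * \<epsilon>\<close>, below the bound
    \<open>- \<epsilon>\<close> valid near the unit sphere.\<close>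
  define \<epsilon> where "\<epsilon> = - w x / 3"
  have \<epsilon>: "\<epsilon> > 0" using neg by (simp add: \<epsilon>_def w_def)
  obtain r where r: "0 < r" "r < 1"
    "\<And>(x :: 'a) y. norm y \<le> norm x \<Longrightarrow> r \<le> norm x \<Longrightarrow> norm x < 1 \<Longrightarrow> u y \<le> u x + \<epsilon>"
    using boundary_comparison[OF \<epsilon>] by blast
  have wr: "w z \<ge> - \<epsilon>" if "norm z < 1" "l \<le> z \<bullet> e" "r \<le> norm z" for z
    using r(3)[of "hyperplane_reflection e l z" z] norm_hyperplane_reflection_le[OF e l, of z] that
    by (simp add: w_def refl_diff_def)
  define h where "h = (\<lambda>z :: 'a. 1 - (K + 1) * (z \<bullet> e - l)\<^sup>2)"
  have h: "1 / 2 \<le> h z" "h z \<le> 1" if "l \<le> z \<bullet> e" "z \<bullet> e \<le> l + \<delta>" for z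
  proof -
    have "(z \<bullet> e - l)\<^sup>2 \<le> \<delta>\<^sup>2" using that by (intro power_mono) auto
    then have "(K + 1) * (z \<bullet> e - l)\<^sup>2 \<le> (K + 1) * \<delta>\<^sup>2" using K_nonneg by (intro mult_left_mono) auto
    then show "1 / 2 \<le> h z" using \<delta> by (simp add: h_def algebra_simps)
    show "h z \<le> 1" using K_nonneg by (simp add: h_def)
  qed
  define A where "A = cball 0 r \<inter> {z. l \<le> z \<bullet> e} \<inter> {z. z \<bullet> e \<le> l + \<delta>}"
  have "closed {z. l \<le> z \<bullet> e}" "closed {z. z \<bullet> e \<le> l + \<delta>}"
    by (intro closed_Collect_le continuous_intros)+
  then have "compact A" unfolding A_def by (intro compact_Int_closed) auto
  moreover have xA: "x \<in> A"
    using wr[of x] x \<epsilon> by (force simp: A_def \<epsilon>_def)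
  moreover have hA: "1 / 2 \<le> h z" "h z \<le> 1" if "z \<in> A" for z
    using h[of z] that by (auto simp: A_def)
  have "continuous_on A (\<lambda>z. w z / h z)"
  proof (intro continuous_intros)
    show "continuous_on A w"
      unfolding w_def using r by (intro continuous_on_refl_diff e l) (auto simp: A_def)
    show "continuous_on A h" unfolding h_def by (intro continuous_intros)
    show "\<forall>z\<in>A. h z \<noteq> 0"
    proof
      fix z assume "z \<in> A"
      then show "h z \<noteq> 0" using hA(1)[of z] by auto
    qed
  qed
  ultimately obtain z where z: "z \<in> A" "\<And>y. y \<in> A \<Longrightarrow> w z / h z \<le> w y / h y"
    using continuous_attains_inf[of A "\<lambda>z. w z / h z"] by blast
  define s where "s = - (w z / h z)"
  have hz: "h z > 0" using hA[OF z(1)] by simp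
  have wz: "w z = - s * h z" using hz by (simp add: s_def)
  have s: "s \<ge> 3 * \<epsilon>"
  proof -
    have "w x / h x \<le> w x"
      using hA[OF xA] neg by (simp add: w_def field_simps mult_le_cancel_left)
    then show ?thesis using z(2)[OF xA] by (simp add: s_def \<epsilon>_def)
  qed
  have wz2: "w z < - \<epsilon>"
  proof -
    have "3 * \<epsilon> * (1 / 2) \<le> s * h z" using s \<epsilon> hA[OF z(1)] by (intro mult_mono) auto
    then show ?thesis using \<epsilon> wz by simp
  qed
  have zA: "norm z \<le> r" "l \<le> z \<bullet> e" "z \<bullet> e \<le> l + \<delta>" using z(1) by (auto simp: A_def)
  have "norm z \<noteq> r" using wr[of z] zA wz2 r by auto
  moreover have "z \<bullet> e \<noteq> l"
    using wz2 \<epsilon> by (auto simp: w_def refl_diff_def hyperplane_reflection_def)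
  moreover have "z \<bullet> e \<noteq> l + \<delta>" using far[of z] wz2 zA r \<epsilon> by (auto simp: w_def)
  ultimately have zi: "norm z < r" "l < z \<bullet> e" "z \<bullet> e < l + \<delta>" using zA by auto
  define U where "U = ball 0 r \<inter> {z. l < z \<bullet> e} \<inter> {z. z \<bullet> e < l + \<delta>}"
  have "open {z. l < z \<bullet> e}" "open {z. z \<bullet> e < l + \<delta>}"
    by (intro open_Collect_less continuous_intros)+
  then have U: "open U" unfolding U_def by auto
  \<comment> \<open>The minimum \<open>- s\<close> of the quotient becomes a contact:
    \<open>w + s * h\<close> is nonnegative on \<open>A\<close> and vanishes at
    \<open>z\<close>.\<close>
  have min: "\<forall>\<^sub>F y in nhds z. w z + s * h z \<le> w y + s * h y"
  proof (rule eventually_mono[OF eventually_nhds_in_open[OF U]])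
    show "z \<in> U" using zi by (auto simp: U_def)
    fix y assume "y \<in> U"
    then have "y \<in> A" by (auto simp: U_def A_def)
    then have "- s \<le> w y / h y" "h y > 0" using z(2)[of y] hA[of y] by (auto simp: s_def)
    then show "w z + s * h z \<le> w y + s * h y" using wz by (simp add: field_simps)
  qed
  let ?z = "hyperplane_reflection e l z"
  have z1: "norm z < 1" "norm ?z < 1"
    using zi r norm_hyperplane_reflection_le[OF e l, of z] by auto
  have "has_laplacian h z (0 - (K + 1) * 2)"
    unfolding h_def
    by (intro has_laplacian_diff has_laplacian_cmult has_laplacian_const has_laplacian_inner_square e)
  then have "has_laplacian (\<lambda>y. w y + s * h y) z (f (u z) - f (u ?z) + s * (0 - (K + 1) * 2))"
    unfolding w_def by (intro has_laplacian_add has_laplacian_cmult has_laplacian_refl_diff e z1)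
  from has_laplacian_local_min[OF this min]
  have ge: "f (u z) - f (u ?z) - 2 * s * (K + 1) \<ge> 0" by (simp add: algebra_simps)
  \<comment> \<open>Negativity of \<open>w\<close> at \<open>z\<close> is what makes the one-sided
    bound \<open>f_quasimono\<close> point the right way.\<close>
  have "u z \<le> u ?z" using wz2 \<epsilon> by (simp add: w_def refl_diff_def)
  from f_quasimono[OF this] have "f (u z) - f (u ?z) \<le> K * (- w z)"
    by (simp add: w_def refl_diff_def algebra_simps)
  also have "\<dots> \<le> K * s"
    using s \<epsilon> hA[OF z(1)] K_nonneg by (intro mult_left_mono) (auto simp: wz mult_left_le)
  finally have "2 * s * (K + 1) \<le> K * s" using ge by linarith
  then have "K * s + 2 * s \<le> 0" by (simp add: algebra_simps)
  moreover have "K * s \<ge> 0" using s \<epsilon> K_nonneg by simp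
  ultimately show False using s \<epsilon> by linarith
qed


text \<open>Strong minimum principle: the positivity set is open and closed in the convex cap. It is
  nonempty since near \<open>e\<close> the solution blows up while its values at the mirror images
  stay bounded.\<close>

lemma refl_diff_pos:
  assumes e: "norm e = 1" and l: "0 < l" "l < 1" and ord: "refl_ordered e l"
    and x: "norm x < 1" "l < x \<bullet> e"
  shows "0 < refl_diff e l x"
proof -
  have ee: "e \<bullet> e = 1" using e by (simp add: dot_square_norm)
  define S where "S = ball 0 1 \<inter> {x. l < x \<bullet> e}"
  define P where "P = {x \<in> S. 0 < refl_diff e l x}"
  have S: "norm z < 1" "norm (hyperplane_reflection e l z) < 1" "l < z \<bullet> e" "0 \<le> refl_diff e l z" if "z \<in> S" for z
    using that norm_hyperplane_reflection_less[OF e l(1), of z] ord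
    by (auto simp: S_def refl_ordered_def)
  have "open {x. l < x \<bullet> e}" by (intro open_Collect_less continuous_intros)
  then have oS: "open S" by (auto simp: S_def)
  have "{x. l < x \<bullet> e} = {x. e \<bullet> x > l}" by (simp add: inner_commute)
  then have "convex S" unfolding S_def by (auto intro!: convex_Int convex_halfspace_gt)
  then have conS: "connected S" by (rule convex_connected)
  have cS: "continuous_on S (refl_diff e l)"
    by (intro continuous_on_refl_diff e) (use l S in force)+
  have "openin (top_of_set S) P"
    unfolding P_def
    using continuous_openin_preimage_gen[OF cS, of "{0<..}"] by (simp add: vimage_def Int_def)
  moreover have "closedin (top_of_set S) P"
  proof (rule closedin_sequentialI)
    fix X z assume X: "\<And>n. X n \<in> P" "z \<in> S" "X \<longlonglongrightarrow> z"
    \<comment> \<open>The comparison ball will be centred at a nearby point \<open>X n\<close>,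
      where positivity is known; the factor 2 keeps it inside \<open>S\<close> while it contains the
      limit \<open>z\<close>.\<close>
    obtain R where R: "R > 0" "cball z (2 * R) \<subseteq> S"
      using open_contains_cball[of S] oS X(2) by (metis half_gt_zero field_sum_of_halves mult_2)
    obtain n where n: "dist (X n) z < R"
      using X(3) R(1) unfolding lim_sequentially by blast
    have sub: "cball (X n) R \<subseteq> S"
    proof
      fix y assume "y \<in> cball (X n) R"
      then have "dist z y \<le> 2 * R" using n dist_triangle[of z y "X n"] by (simp add: dist_commute)
      then show "y \<in> S" using R(2) by auto
    qed
    have cu: "continuous_on (cball (X n) R) u" "continuous_on (cball (X n) R) (\<lambda>y. u (hyperplane_reflection e l y))"
      by (rule continuous_on_u, use S sub in auto)
         (rule continuous_on_compose2[OF continuous_on_u[OF order_refl] continuous_on_hyperplane_reflection], use S sub in auto)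
    obtain c1 where c1: "\<forall>y\<in>cball (X n) R. \<bar>u y\<bar> \<le> c1"
      using continuous_on_compact_abs_bound[OF compact_cball cu(1)] by blast
    obtain c2 where c2: "\<forall>y\<in>cball (X n) R. \<bar>u (hyperplane_reflection e l y)\<bar> \<le> c2"
      using continuous_on_compact_abs_bound[OF compact_cball cu(2)] by blast
    define c where "c = max c1 c2"
    obtain L where L: "L-lipschitz_on {-c..c} f" using f_lipschitz by blast
    have "0 < refl_diff e l z"
    proof (rule positive_on_ball[where c = "X n" and R = R and C = L
          and L = "\<lambda>y. f (u y) - f (u (hyperplane_reflection e l y))"])
      show "continuous_on (cball (X n) R) (refl_diff e l)"
        using continuous_on_subset[OF cS sub] .
      show "0 < refl_diff e l (X n)" using X(1)[of n] by (simp add: P_def)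
      show "0 \<le> L" using lipschitz_on_nonneg[OF L] .
      show "z \<in> ball (X n) R" using n by simp
      fix y
      show "0 \<le> refl_diff e l y" if "y \<in> cball (X n) R" using S sub that by blast
      assume yb: "y \<in> ball (X n) R"
      then have y: "y \<in> cball (X n) R" by simp
      then have yS: "y \<in> S" using sub by blast
      show "has_laplacian (refl_diff e l) y (f (u y) - f (u (hyperplane_reflection e l y)))"
        using has_laplacian_refl_diff[OF e] S[OF yS] by blast
      have "u y \<in> {-c..c}" "u (hyperplane_reflection e l y) \<in> {-c..c}"
        using c1[rule_format, OF y] c2[rule_format, OF y] by (auto simp: c_def)
      from lipschitz_onD[OF L this] S(4)[OF yS]
      show "f (u y) - f (u (hyperplane_reflection e l y)) \<le> L * refl_diff e l y"
        by (simp add: dist_real_def refl_diff_def)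
    qed
    then show "z \<in> P" using X(2) by (simp add: P_def)
  qed (auto simp: P_def)
  ultimately have "P = {} \<or> P = S"
    using conS connected_clopen by blast
  moreover have "P \<noteq> {}"
  proof -
    \<comment> \<open>For \<open>l < t < 1\<close> the mirror image of \<open>t *\<^sub>R e\<close>
      is \<open>(2 * l - t) *\<^sub>R e\<close>, and \<open>2 * l - t\<close> lies between
      \<open>2 * l - 1\<close> and \<open>l\<close>.\<close>
    define \<rho> where "\<rho> = max l \<bar>2 * l - 1\<bar>"
    have "\<rho> < 1" using l by (auto simp: \<rho>_def)
    then obtain C where C: "\<And>x. norm x \<le> \<rho> \<Longrightarrow> \<bar>u x\<bar> \<le> C"
      using bounded_on_cball by blast
    obtain r where r: "r < 1" "\<And>x. r \<le> norm x \<Longrightarrow> norm x < 1 \<Longrightarrow> u x > C"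
      using large_near_sphere[of C] by blast
    define t where "t = (1 + max r l) / 2"
    have t: "r \<le> t" "l < t" "t < 1" "0 < t" using r l by (auto simp: t_def)
    have "hyperplane_reflection e l (t *\<^sub>R e) = (2 * l - t) *\<^sub>R e"
      using ee by (simp add: hyperplane_reflection_def flip: scaleR_add_left)
    moreover have "\<bar>2 * l - t\<bar> \<le> \<rho>" using t l by (auto simp: \<rho>_def)
    ultimately have "u (hyperplane_reflection e l (t *\<^sub>R e)) \<le> C"
      using C[of "(2 * l - t) *\<^sub>R e"] e by simp
    moreover have "u (t *\<^sub>R e) > C" using r(2)[of "t *\<^sub>R e"] t e by simp
    ultimately have "t *\<^sub>R e \<in> P" using t e ee by (simp add: P_def S_def refl_diff_def)
    then show ?thesis by blast
  qed
  ultimately have "P = S" by blast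
  then have "x \<in> P" using x by (simp add: S_def)
  then show ?thesis by (simp add: P_def)
qed

text \<open>Read contrapositively: a failure of the ordering also occurs at distance at least
  \<open>\<delta>\<close> from the plane. This prevents violating points from converging to the
  plane in the limit argument.\<close>

lemma refl_ordered_if_far:
  assumes "norm e = 1" "0 \<le> l" "0 < \<delta>" "2 * (K + 1) * \<delta>\<^sup>2 \<le> 1"
    and "\<And>x. norm x < 1 \<Longrightarrow> l + \<delta> \<le> x \<bullet> e \<Longrightarrow> 0 \<le> refl_diff e l x"
  shows "refl_ordered e l"
  unfolding refl_ordered_def
  using narrow_strip_nonneg[OF assms(1-4)] assms(5) by (metis not_less order_refl)

lemma narrow_width_exists:
  obtains \<delta> where "0 < \<delta>" "\<delta> < 1" "2 * (K + 1) * \<delta>\<^sup>2 \<le> 1"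
proof
  let ?d = "1 / (2 * (K + 1))"
  have 1: "2 * (K + 1) * ?d = 1" using K_nonneg by (simp add: field_simps)
  show 2: "0 < ?d" "?d < 1" using K_nonneg by (simp_all add: field_simps)
  have "2 * (K + 1) * ?d\<^sup>2 = (2 * (K + 1) * ?d) * ?d" by (simp only: power2_eq_square mult.assoc)
  then show "2 * (K + 1) * ?d\<^sup>2 \<le> 1" using 2 unfolding 1 by linarith
qed

text \<open>Openness of the set of ordered positions. Violating points at a fixed distance beyond
  the planes accumulate at a point strictly beyond the limit plane. Inside the ball this contradicts
  \<open>refl_diff_pos\<close>; on the unit sphere \<open>u\<close> blows up while the mirror value
  stays finite.\<close>

lemma not_refl_ordered_limit:
  assumes e: "norm e = 1" and lim: "\<Lambda> \<longlonglongrightarrow> l" and l: "0 < l" "l < 1"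
    and \<Lambda>: "\<And>n. 0 < \<Lambda> n" "\<And>n. \<not> refl_ordered e (\<Lambda> n)"
  shows "\<not> refl_ordered e l"
proof
  assume ord: "refl_ordered e l"
  obtain \<delta> where \<delta>: "\<delta> > 0" "2 * (K + 1) * \<delta>\<^sup>2 \<le> 1"
    using narrow_width_exists by blast
  have "\<exists>x. norm x < 1 \<and> \<Lambda> n + \<delta> \<le> x \<bullet> e \<and> refl_diff e (\<Lambda> n) x < 0" for n
    using refl_ordered_if_far[OF e _ \<delta>, of "\<Lambda> n"] \<Lambda>[of n] by (meson less_imp_le not_less)
  then obtain X where X: "\<And>n. norm (X n) < 1" "\<And>n. \<Lambda> n + \<delta> \<le> X n \<bullet> e" "\<And>n. refl_diff e (\<Lambda> n) (X n) < 0"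
    by metis
  have "bounded (range X)"
    using X(1) by (intro boundedI[of _ 1]) (auto intro: less_imp_le)
  then obtain x \<sigma> where \<sigma>: "strict_mono \<sigma>" "(X \<circ> \<sigma>) \<longlonglongrightarrow> x"
    using bounded_imp_convergent_subsequence by blast
  have limX: "(\<lambda>n. X (\<sigma> n)) \<longlonglongrightarrow> x" using \<sigma>(2) by (simp add: o_def)
  have limL: "(\<lambda>n. \<Lambda> (\<sigma> n)) \<longlonglongrightarrow> l" using LIMSEQ_subseq_LIMSEQ[OF lim \<sigma>(1)] by (simp add: o_def)
  have nx: "norm x \<le> 1"
    by (rule LIMSEQ_le_const2[OF tendsto_norm[OF limX]]) (use X(1) less_imp_le in blast)
  have "l + \<delta> \<le> x \<bullet> e"
    by (rule LIMSEQ_le[OF tendsto_add[OF limL tendsto_const] tendsto_inner[OF limX tendsto_const]])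
       (use X(2) in auto)
  then have xe: "l < x \<bullet> e" using \<delta> by simp
  let ?y = "hyperplane_reflection e l x"
  have y: "norm ?y < 1" using norm_hyperplane_reflection_less[OF e l(1) xe] nx by simp
  show False
  proof (cases "norm x = 1")
    case False
    then have x1: "norm x < 1" using nx by simp
    have "refl_diff e l x \<le> 0"
      by (rule LIMSEQ_le_const2[OF tendsto_refl_diff[OF limL limX x1 y]])
         (use X(3) less_imp_le in blast)
    then show False using refl_diff_pos[OF e l ord x1 xe] by simp
  next
    case True
    have "(\<lambda>n. u (hyperplane_reflection e (\<Lambda> (\<sigma> n)) (X (\<sigma> n)))) \<longlonglongrightarrow> u ?y"
      by (rule isCont_tendsto_compose[OF isCont_u[OF y]]) (intro tendsto_intros limL limX)
    then have ev1: "\<forall>\<^sub>F n in sequentially. u (hyperplane_reflection e (\<Lambda> (\<sigma> n)) (X (\<sigma> n))) < u ?y + 1"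
      by (rule order_tendstoD(2)) simp
    obtain r where r: "r < 1" "\<And>x. r \<le> norm x \<Longrightarrow> norm x < 1 \<Longrightarrow> u x > u ?y + 1"
      using large_near_sphere[of "u ?y + 1"] by blast
    have ev2: "\<forall>\<^sub>F n in sequentially. r < norm (X (\<sigma> n))"
      using order_tendstoD(1)[OF tendsto_norm[OF limX], of r] True r by simp
    have "\<forall>\<^sub>F n in sequentially. False"
      using ev1 ev2
    proof eventually_elim
      case (elim n)
      then have "u (X (\<sigma> n)) > u ?y + 1" using r(2)[of "X (\<sigma> n)"] X(1)[of "\<sigma> n"] by simp
      then show ?case using elim X(3)[of "\<sigma> n"] by (simp add: refl_diff_def)
    qed
    then show False by simp
  qed
qed

text \<open>Closedness of the set of ordered positions, by continuity. The value
  \<open>l = 0\<close> is included because symmetry comes from planes through the origin.\<close>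

lemma refl_ordered_limit:
  assumes e: "norm e = 1" and lim: "\<Lambda> \<longlonglongrightarrow> l" and l: "0 \<le> l"
    and \<Lambda>: "\<And>n. refl_ordered e (\<Lambda> n)"
  shows "refl_ordered e l"
  unfolding refl_ordered_def
proof (intro allI impI)
  fix x assume x: "norm x < 1" "l < x \<bullet> e"
  have y: "norm (hyperplane_reflection e l x) < 1"
    using norm_hyperplane_reflection_le[OF e l, of x] x by simp
  have "\<forall>\<^sub>F n in sequentially. \<Lambda> n < x \<bullet> e" by (rule order_tendstoD(2)[OF lim x(2)])
  then have "\<forall>\<^sub>F n in sequentially. 0 \<le> refl_diff e (\<Lambda> n) x"
    by eventually_elim (use \<Lambda> x in \<open>auto simp: refl_ordered_def\<close>)
  then show "0 \<le> refl_diff e l x"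
    by (rule tendsto_lowerbound[OF tendsto_refl_diff[OF lim tendsto_const x(1) y]]) simp
qed

text \<open>The plane moves by connectedness of the open interval from 0 to 1. It starts at
  \<open>1 - \<delta>\<close>, where the whole cap is a narrow strip because
  \<open>x \<bullet> e < 1\<close> in the ball.\<close>

lemma refl_ordered_all:
  assumes e: "norm e = 1" and l: "0 < l" "l < 1"
  shows "refl_ordered e l"
proof -
  define T where "T = {l \<in> {0<..<1}. refl_ordered e l}"
  have "closedin (top_of_set {0<..<1}) T"
  proof (rule closedin_sequentialI)
    fix X z assume "\<And>n. X n \<in> T" "z \<in> {0<..<1}" "X \<longlonglongrightarrow> z"
    then show "z \<in> T" using refl_ordered_limit[OF e, of X z] by (auto simp: T_def)
  qed (auto simp: T_def)
  moreover have "closedin (top_of_set {0<..<1}) ({0<..<1} - T)"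
  proof (rule closedin_sequentialI)
    fix X z assume "\<And>n. X n \<in> {0<..<1} - T" "z \<in> {0<..<1}" "X \<longlonglongrightarrow> z"
    then show "z \<in> {0<..<1} - T"
      using not_refl_ordered_limit[OF e, of X z] by (auto simp: T_def)
  qed auto
  then have "openin (top_of_set {0<..<1}) T"
    by (simp add: openin_closedin_eq) (auto simp: T_def)
  ultimately have "T = {} \<or> T = {0<..<1}"
    using connected_clopen connected_Ioo by metis
  moreover have "T \<noteq> {}"
  proof -
    obtain \<delta> where \<delta>: "\<delta> > 0" "2 * (K + 1) * \<delta>\<^sup>2 \<le> 1" "\<delta> < 1"
      using narrow_width_exists by blast
    have "refl_ordered e (1 - \<delta>)"
    proof (rule refl_ordered_if_far[OF e _ \<delta>(1,2)])
      fix x assume "norm x < 1" "1 - \<delta> + \<delta> \<le> x \<bullet> e"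
      moreover have "x \<bullet> e \<le> norm x * norm e" by (rule norm_cauchy_schwarz)
      ultimately show "0 \<le> refl_diff e (1 - \<delta>) x" using e by simp
    qed (use \<delta> in simp)
    then have "1 - \<delta> \<in> T" using \<delta> by (simp add: T_def)
    then show ?thesis by blast
  qed
  ultimately have "T = {0<..<1}" by blast
  then have "l \<in> T" using l by simp
  then show ?thesis by (simp add: T_def)
qed

section \<open>Radial symmetry and monotonicity\<close>

text \<open>The two points are mirror images in the plane at height
  \<open>(s + t) / 2\<close>.\<close>

lemma radial_increasing:
  assumes e: "norm e = 1" and st: "0 \<le> s" "s < t" "t < 1"
  shows "u (s *\<^sub>R e) \<le> u (t *\<^sub>R e)"
proof -
  have ee: "e \<bullet> e = 1" using e by (simp add: dot_square_norm)
  have "refl_ordered e ((s + t) / 2)" using st by (intro refl_ordered_all e) auto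
  then have "0 \<le> refl_diff e ((s + t) / 2) (t *\<^sub>R e)"
    using st e ee by (simp add: refl_ordered_def)
  moreover have "t + 2 * ((s + t) / 2 - t) = s" by (simp add: field_simps)
  then have "hyperplane_reflection e ((s + t) / 2) (t *\<^sub>R e) = s *\<^sub>R e"
    using ee by (simp add: hyperplane_reflection_def flip: scaleR_add_left)
  ultimately show ?thesis by (simp add: refl_diff_def)
qed

text \<open>Distinct points of equal norm are mirror images in a plane through the origin, and the
  ordering at \<open>l = 0\<close> is the limit of the orderings at positive positions.\<close>

lemma radially_symmetric_le:
  assumes n: "norm x = norm y" "norm x < 1"
  shows "u y \<le> u x"
proof (cases "x = y")
  case False
  define e where "e = sgn (x - y)"
  have e: "norm e = 1" using False by (simp add: e_def norm_sgn)
  have d: "norm (x - y) > 0" using False by simp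
  have d2: "(norm (x - y))\<^sup>2 = 2 * (x \<bullet> (x - y))"
    using n(1) unfolding power2_norm_eq_inner
    by (simp add: inner_simps inner_commute norm_eq)
  have "x \<bullet> e = (x \<bullet> (x - y)) / norm (x - y)"
    by (simp add: e_def sgn_div_norm divide_inverse mult.commute)
  also have "x \<bullet> (x - y) = norm (x - y) * norm (x - y) / 2" using d2 by (simp add: power2_eq_square)
  finally have xe: "x \<bullet> e = norm (x - y) / 2" using d by simp
  have "hyperplane_reflection e 0 x = x - (2 * (x \<bullet> e)) *\<^sub>R e"
    by (simp add: hyperplane_reflection_def)
  also have "\<dots> = y" using d unfolding xe by (simp add: e_def sgn_div_norm)
  finally have y: "hyperplane_reflection e 0 x = y" .
  have "refl_ordered e 0"
  proof (rule refl_ordered_limit[OF e])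
    show "(\<lambda>n. inverse (real (Suc (Suc n)))) \<longlonglongrightarrow> 0"
      using LIMSEQ_Suc[OF LIMSEQ_inverse_real_of_nat] by simp
    show "refl_ordered e (inverse (real (Suc (Suc n))))" for n
      by (rule refl_ordered_all[OF e]) (auto simp: field_simps)
  qed simp
  moreover have "0 < x \<bullet> e" unfolding xe using d by simp
  ultimately have "0 \<le> refl_diff e 0 x" using n(2) unfolding refl_ordered_def by blast
  then show ?thesis by (simp add: refl_diff_def y)
qed simp

lemma radially_symmetric:
  "norm x = norm y \<Longrightarrow> norm x < 1 \<Longrightarrow> u x = u y"
  using radially_symmetric_le[of x y] radially_symmetric_le[of y x] by simp

text \<open>
  Where the nonnegative radial derivative vanishes, it has a minimum, so \<open>f \<circ> u\<close> vanishes there as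
  well and uniqueness for the radial ODE would make \<open>u\<close> constant farther out.
\<close>

lemma radial_derivative_pos:
  assumes x: "norm x < 1" "x \<noteq> 0"
  shows "u_r x > 0"
proof -
  define e where "e = sgn x"
  have e: "norm e = 1" using x by (simp add: e_def norm_sgn)
  define p where "p = (\<lambda>r. u (r *\<^sub>R e))"
  define p' where "p' = (\<lambda>r. u_r (r *\<^sub>R e))"
  define p'' where "p'' = (\<lambda>r. u_rr (r *\<^sub>R e))"
  define m where "m = real DIM('a) - 1"
  have m: "m \<ge> 0" by (simp add: m_def Suc_leI)
  have sgn: "sgn (r *\<^sub>R e) = e" "norm (r *\<^sub>R e) = r" if "0 < r" for r
    using that e by (simp_all add: sgn_scaleR) (simp add: sgn_div_norm)
  have e0: "e \<noteq> 0" using e by auto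
  have sd: "has_second_deriv p r (p' r) (p'' r)" if "0 < r" "r < 1" for r
    using has_second_deriv_radial[of "r *\<^sub>R e"] that e e0
    unfolding p_def p'_def p''_def sgn[OF that(1)] by auto
  have dp: "(p has_real_derivative p' r) (at r)" if "0 < r" "r < 1" for r
    using has_second_deriv_imp_deriv[OF sd[OF that]] .
  \<comment> \<open>\<open>has_second_deriv\<close> hides its derivative function. By uniqueness of
    derivatives that function agrees with \<open>p'\<close> near \<open>r\<close>, so
    \<open>p'\<close> inherits its differentiability.\<close>
  have dp': "(p' has_real_derivative p'' r) (at r)" if r: "0 < r" "r < 1" for r
  proof -
    obtain g where g: "\<forall>\<^sub>F s in nhds r. (p has_real_derivative g s) (at s)" "(g has_real_derivative p'' r) (at r)"
      using sd[OF r] unfolding has_second_deriv_def by blast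
    have "\<forall>\<^sub>F s in nhds r. s \<in> {0<..<1}" by (rule eventually_nhds_in_open) (use r in auto)
    then have "\<forall>\<^sub>F s in nhds r. p' s = g s"
      using g(1) by eventually_elim (meson DERIV_unique dp greaterThanLessThan_iff)
    then show ?thesis using g(2) by (subst DERIV_cong_ev[OF refl _ refl])
  qed
  \<comment> \<open>By symmetry every point is both a maximum and a minimum of \<open>u\<close> on
    its sphere, so the two sphere inequalities combine to an equation.\<close>
  have ode: "p'' r + m / r * p' r = f (p r)" if r: "0 < r" "r < 1" for r
  proof -
    have eq: "u z = u (r *\<^sub>R e)" if "norm z = norm (r *\<^sub>R e)" for z
      using radially_symmetric[OF that] that r sgn(2)[of r] by simp
    have z: "norm (r *\<^sub>R e) < 1" "r *\<^sub>R e \<noteq> 0" using r e by auto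
    have "f (u (r *\<^sub>R e)) \<le> u_rr (r *\<^sub>R e) + m / r * u_r (r *\<^sub>R e)"
      using f_le_at_sphere_max[OF z eq_refl[OF eq]] unfolding sgn(2)[OF r(1)] m_def .
    moreover have "u_rr (r *\<^sub>R e) + m / r * u_r (r *\<^sub>R e) \<le> f (u (r *\<^sub>R e))"
      using f_ge_at_sphere_min[OF z eq_refl[OF eq[symmetric]]] unfolding sgn(2)[OF r(1)] m_def .
    ultimately show ?thesis by (simp add: p_def p'_def p''_def)
  qed
  have nonneg: "p' r \<ge> 0" if r: "0 < r" "r < 1" for r
  proof (rule ccontr)
    assume "\<not> p' r \<ge> 0"
    then obtain d where d: "d > 0" "\<And>h. 0 < h \<Longrightarrow> h < d \<Longrightarrow> p (r + h) < p r"
      using has_real_derivative_neg_dec_right[OF dp[OF r]] by auto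
    obtain h where h: "0 < h" "h < d" "h < 1 - r"
      using field_lbound_gt_zero[OF d(1), of "1 - r"] r by auto
    have "p r \<le> p (r + h)"
      unfolding p_def by (rule radial_increasing[OF e]) (use h r in auto)
    then show False using d(2)[OF h(1,2)] by simp
  qed
  define r where "r = norm x"
  have r: "0 < r" "r < 1" using x by (auto simp: r_def)
  have xr: "r *\<^sub>R e = x" using x by (simp add: r_def e_def sgn_div_norm)
  have "p' r \<noteq> 0"
  proof
    assume p'0: "p' r = 0"
    have "p'' r = 0"
    proof (rule DERIV_local_min[OF dp'[OF r]])
      show "0 < min r (1 - r)" using r by simp
      show "\<forall>y. \<bar>r - y\<bar> < min r (1 - r) \<longrightarrow> p' r \<le> p' y"
        using nonneg p'0 by auto
    qed
    then have f0: "f (p r) = 0" using ode[OF r] p'0 by simp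
    have const: "p t = p r" if t: "r \<le> t" "t < 1" for t
    proof -
      obtain C where C: "\<And>z. norm z \<le> t \<Longrightarrow> \<bar>u z\<bar> \<le> C" using bounded_on_cball[OF t(2)] by blast
      have pC: "p s \<in> {-C..C}" if "r \<le> s" "s \<le> t" for s
        using C[of "s *\<^sub>R e"] sgn(2)[of s] that r by (auto simp: p_def)
      obtain L where L: "L-lipschitz_on {-C..C} f" using f_lipschitz by blast
      have L0: "L \<ge> 0" using lipschitz_on_nonneg[OF L] .
      define E where "E = (\<lambda>s. ((p s - p r)\<^sup>2 + (p' s)\<^sup>2) * exp (- (1 + L) * s))"
      define E' where "E' = (\<lambda>s. (2 * (p s - p r) * p' s + 2 * p' s * p'' s
          - (1 + L) * ((p s - p r)\<^sup>2 + (p' s)\<^sup>2)) * exp (- (1 + L) * s))"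
      have "E t \<le> E r"
      proof (rule DERIV_nonpos_imp_nonincreasing[OF t(1)])
        fix s assume s: "r \<le> s" "s \<le> t"
        have s01: "0 < s" "s < 1" using s r t by auto
        have "(E has_real_derivative E' s) (at s)"
          unfolding E_def E'_def
          by (rule derivative_eq_intros dp[OF s01] dp'[OF s01] refl | simp)+
             (simp add: algebra_simps power2_eq_square)
        moreover have "E' s \<le> 0"
        proof -
          have "\<bar>f (p s) - f (p r)\<bar> \<le> L * \<bar>p s - p r\<bar>"
            using lipschitz_onD[OF L pC[OF s] pC[of r]] t by (simp add: dist_real_def)
          then have fs: "f (p s) \<le> L * \<bar>p s - p r\<bar>" using f0 by simp
          have "m / s * p' s \<ge> 0" using m s01 nonneg[OF s01] by simp
          then have "p'' s \<le> L * \<bar>p s - p r\<bar>" using ode[OF s01] fs by linarith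
          then have "2 * p' s * p'' s \<le> 2 * p' s * (L * \<bar>p s - p r\<bar>)"
            using nonneg[OF s01] by (intro mult_left_mono) auto
          also have "\<dots> = L * (2 * \<bar>p s - p r\<bar> * p' s)" by (simp add: algebra_simps)
          also have "\<dots> \<le> L * (\<bar>p s - p r\<bar>\<^sup>2 + (p' s)\<^sup>2)"
            by (intro mult_left_mono sum_squares_bound L0)
          finally have 1: "2 * p' s * p'' s \<le> L * ((p s - p r)\<^sup>2 + (p' s)\<^sup>2)" by simp
          have 2: "2 * (p s - p r) * p' s \<le> (p s - p r)\<^sup>2 + (p' s)\<^sup>2" by (rule sum_squares_bound)
          have "2 * (p s - p r) * p' s + 2 * p' s * p'' s - (1 + L) * ((p s - p r)\<^sup>2 + (p' s)\<^sup>2) \<le> 0"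
            using 1 2 by (simp add: algebra_simps)
          then show ?thesis unfolding E'_def by (intro mult_nonpos_nonneg) auto
        qed
        ultimately show "\<exists>y. (E has_real_derivative y) (at s) \<and> y \<le> 0" by blast
      qed
      also have "E r = 0" by (simp add: E_def p'0)
      finally have "(p t - p r)\<^sup>2 + (p' t)\<^sup>2 \<le> 0" by (simp add: E_def mult_le_0_iff)
      then have "(p t - p r)\<^sup>2 \<le> 0" using zero_le_power2[of "p' t"] by linarith
      then show ?thesis by simp
    qed
    obtain r' where r': "0 < r'" "r' < 1" "\<And>z. r' \<le> norm z \<Longrightarrow> norm z < 1 \<Longrightarrow> u z > p r"
      using large_near_sphere[of "p r"] by blast
    define t where "t = max r r'"
    have t: "r \<le> t" "t < 1" "r' \<le> t" using r r' by (auto simp: t_def)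
    then have "p t > p r" using r'(3)[of "t *\<^sub>R e"] sgn(2)[of t] r by (simp add: p_def)
    then show False using const[OF t(1,2)] by simp
  qed
  then show ?thesis using nonneg[OF r] by (simp add: p'_def xr)
qed

end

section \<open>From the stated definitions to the locale\<close>

text \<open>The first directional derivative is identified with \<open>Du\<close> only on
  \<open>S\<close>. As \<open>S\<close> is open this holds near the base point, which suffices to
  differentiate again.\<close>

lemma laplacian_eq_trace:
  fixes u :: "'a::euclidean_space \<Rightarrow> real"
  assumes S: "open S" "x \<in> S"
    and Du: "\<And>x. x \<in> S \<Longrightarrow> (u has_derivative blinfun_apply (Du x)) (at x)"
    and D2u: "\<And>x. x \<in> S \<Longrightarrow> (Du has_derivative blinfun_apply (D2u x)) (at x)"
  shows "laplacian u x = (\<Sum>b\<in>Basis. D2u x b b)"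
  unfolding laplacian_def
proof (rule sum.cong[OF refl])
  fix b :: 'a
  have line: "((\<lambda>t. y + t *\<^sub>R b) has_derivative (\<lambda>t. t *\<^sub>R b)) (at 0)" for y
    by (auto intro!: derivative_eq_intros)
  have 1: "directional_deriv b u y = Du y b" if "y \<in> S" for y
  proof -
    have "((\<lambda>t. u (y + t *\<^sub>R b)) has_derivative (\<lambda>t. Du y (t *\<^sub>R b))) (at 0)"
      using has_derivative_compose[OF line, of u "Du y" y] Du[OF that] by simp
    then have "((\<lambda>t. u (y + t *\<^sub>R b)) has_real_derivative Du y b) (at 0)"
      by (simp add: has_field_derivative_def blinfun.scaleR_right mult_commute_abs)
    then show ?thesis unfolding directional_deriv_def by (rule DERIV_imp_deriv)
  qed
  have "((\<lambda>t. Du (x + t *\<^sub>R b)) has_derivative (\<lambda>t. D2u x (t *\<^sub>R b))) (at 0)"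
    using has_derivative_compose[OF line, of Du "D2u x" x] D2u[OF S(2)] by simp
  then have "((\<lambda>t. Du (x + t *\<^sub>R b) b) has_derivative (\<lambda>t. D2u x (t *\<^sub>R b) b)) (at 0)"
    by (rule bounded_linear.has_derivative[OF blinfun.bounded_linear_left])
  then have 2: "((\<lambda>t. Du (x + t *\<^sub>R b) b) has_real_derivative D2u x b b) (at 0)"
    by (simp add: has_field_derivative_def blinfun.scaleR_right blinfun.scaleR_left mult_commute_abs)
  have "\<forall>\<^sub>F t in nhds 0. t \<in> (\<lambda>t. x + t *\<^sub>R b) -` S"
    by (rule eventually_nhds_in_open) (auto intro!: open_vimage S continuous_intros simp: S(2))
  then have "\<forall>\<^sub>F t in nhds 0. directional_deriv b u (x + t *\<^sub>R b) = Du (x + t *\<^sub>R b) b"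
    by eventually_elim (simp add: 1)
  then have "((\<lambda>t. directional_deriv b u (x + t *\<^sub>R b)) has_real_derivative D2u x b b) (at 0)"
    using 2 by (subst DERIV_cong_ev[OF refl _ refl])
  then show "directional_deriv b (directional_deriv b u) x = D2u x b b"
    unfolding directional_deriv_def[of b "directional_deriv b u"] by (rule DERIV_imp_deriv)
qed

lemma C1_imp_lipschitz_on_interval:
  fixes f :: "real \<Rightarrow> real"
  assumes "f C1_differentiable_on UNIV"
  shows "\<exists>L. L-lipschitz_on {-c..c} f"
proof -
  obtain D where D: "\<And>x. (f has_real_derivative D x) (at x)" "continuous_on UNIV D"
    using assms unfolding C1_differentiable_on_def has_real_derivative_iff_has_vector_derivative by auto
  have "continuous_on {-c..c} D" using D(2) continuous_on_subset by blast
  then obtain L where L: "\<And>x. x \<in> {-c..c} \<Longrightarrow> \<bar>D x\<bar> \<le> L"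
    using continuous_on_compact_abs_bound[of "{-c..c}" D] compact_Icc by blast
  have "\<bar>L\<bar>-lipschitz_on {-c..c} f"
  proof (rule lipschitz_onI)
    fix x y assume "x \<in> {-c..c}" "y \<in> {-c..c}"
    then have "norm (f x - f y) \<le> \<bar>L\<bar> * norm (x - y)"
      by (intro field_differentiable_bound[of "{-c..c}" f D])
         (use L in \<open>auto intro: has_field_derivative_at_within D(1) order_trans[OF L abs_ge_self]\<close>)
    then show "dist (f x) (f y) \<le> \<bar>L\<bar> * dist x y" by (simp add: dist_norm)
  qed simp
  then show ?thesis by blast
qed

theorem corollary1p7:
  fixes f ft :: "real \<Rightarrow> real"
    and a K :: real
    and u :: "real ^ 'n \<Rightarrow> real"
  assumes "f C1_differentiable_on UNIV"
    and "f a > 0"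
    and "\<forall>t>a. f t \<ge> 0"
    and "\<exists>b>a. set_integrable lborel {b..} (\<lambda>t. 1 / sqrt (integral {a..t} f))"
    and "mono ft"
    and "\<forall>t. f t = ft t - K * t"
    and "large_solution f (ball 0 1) u"
  shows "radially_symmetric_on (ball 0 1) u \<and>
         (\<forall>x\<in>ball 0 1 - {0}. radial_deriv u x > 0)"
proof -
  obtain Du D2u where Du: "\<And>x. x \<in> ball 0 1 \<Longrightarrow> (u has_derivative blinfun_apply (Du x)) (at x)"
    and D2u: "\<And>x. x \<in> ball 0 1 \<Longrightarrow> (Du has_derivative blinfun_apply (D2u x)) (at x)"
    using assms(7) unfolding large_solution_def C2_on_def by blast
  \<comment> \<open>The absolute value secures \<open>K_nonneg\<close>, and the added term
    \<open>(\<bar>K\<bar> - K) * t\<close> is nondecreasing in \<open>t\<close>.\<close>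
  interpret large_ball_solution f a "\<bar>K\<bar>" u Du D2u
  proof
    fix x :: "real ^ 'n" assume x: "norm x < 1"
    show "(u has_derivative blinfun_apply (Du x)) (at x)" "(Du has_derivative blinfun_apply (D2u x)) (at x)"
      using Du D2u x by auto
    show "(\<Sum>b\<in>Basis. D2u x b b) = f (u x)"
    proof -
      have xb: "x \<in> ball 0 1" using x by simp
      then have "laplacian u x = f (u x)" using assms(7) unfolding large_solution_def by blast
      then show ?thesis using laplacian_eq_trace[OF open_ball xb Du D2u] by simp
    qed
  next
    fix x :: "real ^ 'n" assume "norm x = 1"
    then show "filterlim u at_top (at x within ball 0 1)"
      using assms(7) by (simp add: large_solution_def frontier_ball)
  next
    fix s t :: real assume st: "s \<le> t"
    have "ft s \<le> ft t" using assms(5) st by (rule monoD)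
    moreover have "(\<bar>K\<bar> - K) * s \<le> (\<bar>K\<bar> - K) * t" using st by (intro mult_left_mono) auto
    moreover have "f s = ft s - K * s" "f t = ft t - K * t" using assms(6) by auto
    ultimately show "f s + \<bar>K\<bar> * s \<le> f t + \<bar>K\<bar> * t" by (simp add: algebra_simps)
  qed (use assms(3) C1_imp_lipschitz_on_interval[OF assms(1)] in auto)
  \<comment> \<open>The values of \<open>u\<close> along the ray through any unit vector serve as
    the radial profile.\<close>
  obtain b :: "real ^ 'n" where b: "norm b = 1" using vector_choose_size[of 1] by auto
  have "u x = u (norm x *\<^sub>R b)" if "x \<in> ball 0 1" for x
    using radially_symmetric[of x "norm x *\<^sub>R b"] b that by simp
  then have "radially_symmetric_on (ball 0 1) u"
    unfolding radially_symmetric_on_def by (intro exI[of _ "\<lambda>r. u (r *\<^sub>R b)"]) blast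
  moreover have "radial_deriv u x > 0" if "x \<in> ball 0 1 - {0}" for x
  proof -
    have x: "norm x < 1" "x \<noteq> 0" using that by auto
    have "radial_deriv u x = u_r x"
      unfolding radial_deriv_def
      by (rule DERIV_imp_deriv[OF has_second_deriv_imp_deriv[OF has_second_deriv_radial[OF x]]])
    then show ?thesis using radial_derivative_pos[OF x] by simp
  qed
  ultimately show ?thesis by blast
qed

end
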